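(* Let $D\subset\mathbb{R}^2$ be an open neighborhood of the origin, let $Z^{+}=(X^+,Y^+)$ and $Z^{-}=(X^-,Y^-)$ be planar vector fields on $D$, and consider the Filippov vector field $Z$ equal to $Z^+$ for $y>0$ and to $Z^-$ for $y<0$, with discontinuity line $\Sigma=\{(x,0):x\in\mathbb{R}\}$. Suppose that $Z^{+}$ (resp. $Z^{-}$) is analytic and has an invisible contact of multiplicity $2k^{+}$ (resp. $2k^{-}$) with $\Sigma$ at the origin, for a positive integer $k^{+}$ (resp. $k^-$). Then the half-return map $\varphi^{+}$ (resp. $\varphi^{-}$) is analytic in a neighborhood of $x=0$.
   Context: Let $h(x,y)=y$. For a vector field $F$, $Fh=\langle\nabla h,F\rangle$ is the Lie derivative and $F^{n}h=F(F^{n-1}h)$ for $n>1$. The origin is a contact of multiplicity $m$ between $F$ and $\Sigma$ if $Fh(0,0)=\dots=F^{m-1}h(0,0)=0$ and $F^{m}h(0,0)\neq0$ (equivalently, $0$ is a root of multiplicity $m$ of $t\mapsto h(\varphi_F(t))$, where $\varphi_F$ is the trajectory of $F$ starting at the origin). A contact of even multiplicity $2k$ is called invisible for $Z^+$ if $(Z^+)^{2k}h(0,0)<0$, and invisible for $Z^-$ if $(Z^-)^{2k}h(0,0)>0$. Half-return maps: under these hypotheses, for $x\neq 0$ close to $0$, the orbit of $Z^{+}$ through $(x,0)$, restricted to $\{y\ge 0\}$ (resp. of $Z^-$, restricted to $\{y\le0\}$), followed forward or backward in time (whichever direction enters $\{y>0\}$, resp. $\{y<0\}$), meets $\Sigma$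 again for the first time at a point $(\varphi^{+}(x),0)$ (resp. $(\varphi^{-}(x),0)$) near the origin, on the other side of the origin. One sets $\varphi^{\pm}(0)=0$. The maps $\varphi^\pm$ are involutions near $0$. *)

theory Defs
  imports "HOL-Analysis.Analysis"
begin

(* The library's analytic_on only covers functions of one complex variable. *)

definition real_analytic_on :: "(real \<Rightarrow> real) \<Rightarrow> real set \<Rightarrow> bool" where
  "real_analytic_on f S \<longleftrightarrow>
     (\<forall>a\<in>S. \<exists>r>0. \<exists>c :: nat \<Rightarrow> real. \<forall>u. \<bar>u\<bar> < r \<longrightarrow>
        (\<lambda>n. c n * u ^ n) sums f (a + u))"

definition real_analytic_on2 :: "(real \<times> real \<Rightarrow> real) \<Rightarrow> (real \<times> real) set \<Rightarrow> bool" where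
  "real_analytic_on2 f S \<longleftrightarrow>
     (\<forall>p\<in>S. \<exists>r>0. \<exists>c :: nat \<Rightarrow> nat \<Rightarrow> real. \<forall>u v. \<bar>u\<bar> < r \<and> \<bar>v\<bar> < r \<longrightarrow>
        ((\<lambda>(i, j). c i j * u ^ i * v ^ j) has_sum f (p + (u, v))) UNIV)"

definition analytic_vector_field_on ::
    "(real \<times> real \<Rightarrow> real \<times> real) \<Rightarrow> (real \<times> real) set \<Rightarrow> bool" where
  "analytic_vector_field_on F D \<longleftrightarrow>
     real_analytic_on2 (\<lambda>p. fst (F p)) D \<and> real_analytic_on2 (\<lambda>p. snd (F p)) D"

(* The derivative of g at p applied to the vector F p is the inner product of
   the gradient of g at p with F p. *)

definition lie_derivative ::
    "(real \<times> real \<Rightarrow> real \<times> real) \<Rightarrow> (real \<times> real \<Rightarrow> real) \<Rightarrow> (real \<times> real \<Rightarrow> real)" where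
  "lie_derivative F g = (\<lambda>p. frechet_derivative g (at p) (F p))"

abbreviation iterated_lie_derivative ::
    "(real \<times> real \<Rightarrow> real \<times> real) \<Rightarrow> nat \<Rightarrow> (real \<times> real \<Rightarrow> real) \<Rightarrow> (real \<times> real \<Rightarrow> real)" where
  "iterated_lie_derivative F n g \<equiv> (lie_derivative F ^^ n) g"

(* The line y = 0 is the zero set of the function snd. *)

definition contact_of_multiplicity :: "(real \<times> real \<Rightarrow> real \<times> real) \<Rightarrow> nat \<Rightarrow> bool" where
  "contact_of_multiplicity F m \<longleftrightarrow>
     (\<forall>i. 1 \<le> i \<and> i < m \<longrightarrow> iterated_lie_derivative F i snd (0, 0) = 0) \<and>
     iterated_lie_derivative F m snd (0, 0) \<noteq> 0"

definition invisible_contact_plus :: "(real \<times> real \<Rightarrow> real \<times> real) \<Rightarrow> nat \<Rightarrow> bool" where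
  "invisible_contact_plus F k \<longleftrightarrow>
     contact_of_multiplicity F (2 * k) \<and> iterated_lie_derivative F (2 * k) snd (0, 0) < 0"

definition invisible_contact_minus :: "(real \<times> real \<Rightarrow> real \<times> real) \<Rightarrow> nat \<Rightarrow> bool" where
  "invisible_contact_minus F k \<longleftrightarrow>
     contact_of_multiplicity F (2 * k) \<and> iterated_lie_derivative F (2 * k) snd (0, 0) > 0"

definition upper_half_plane :: "(real \<times> real) set" where
  "upper_half_plane = {p. 0 < snd p}"

definition lower_half_plane :: "(real \<times> real) set" where
  "lower_half_plane = {p. snd p < 0}"

(* The orbit of F through (x, 0) enters the open half-plane H, stays in it, and meets
   the line y = 0 again for the first time at (x', 0).  The time T may be of either
   sign: T < 0 means that the orbit is followed backwards. *)

definition first_return ::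
    "(real \<times> real) set \<Rightarrow> (real \<times> real) set \<Rightarrow> (real \<times> real \<Rightarrow> real \<times> real) \<Rightarrow> real \<Rightarrow> real \<Rightarrow> bool" where
  "first_return D H F x x' \<longleftrightarrow>
     (\<exists>(T :: real) \<gamma>. T \<noteq> 0 \<and>
        (\<forall>t\<in>closed_segment 0 T. \<gamma> t \<in> D \<and>
           (\<gamma> has_vector_derivative F (\<gamma> t)) (at t within closed_segment 0 T)) \<and>
        \<gamma> 0 = (x, 0) \<and> \<gamma> T = (x', 0) \<and>
        (\<forall>t\<in>open_segment 0 T. \<gamma> t \<in> H))"

definition half_return ::
    "(real \<times> real) set \<Rightarrow> (real \<times> real) set \<Rightarrow> (real \<times> real \<Rightarrow> real \<times> real) \<Rightarrow> real \<Rightarrow> real" where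
  "half_return D H F x = (if x = 0 then 0 else (THE x'. first_return D H F x x'))"

(* Uniqueness of the return point makes the definite description above meaningful. *)

definition half_return_analytic_near_0 ::
    "(real \<times> real) set \<Rightarrow> (real \<times> real) set \<Rightarrow> (real \<times> real \<Rightarrow> real \<times> real) \<Rightarrow> bool" where
  "half_return_analytic_near_0 D H F \<longleftrightarrow>
     (\<exists>\<epsilon>>0. (\<forall>x. x \<noteq> 0 \<and> \<bar>x\<bar> < \<epsilon> \<longrightarrow> (\<exists>!x'. first_return D H F x x')) \<and>
        real_analytic_on (half_return D H F) {- \<epsilon> <..< \<epsilon>})"

end

theory Submission
  imports Defs "HOL-Complex_Analysis.Complex_Analysis"
begin

text \<open>
  At a contact the first component of the field does not vanish at the origin, so nearby orbits
  are graphs of solutions of the scalar equation \<open>dy/dx = f x y\<close>, with \<open>f\<close> the quotient of the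
  two components. Extend \<open>f\<close> to a complex bidisc and let \<open>i x\<close> be the value at \<open>0\<close> of the solution
  vanishing at \<open>x\<close>; Picard iteration makes \<open>i\<close> holomorphic. Two points \<open>(x, 0)\<close> and \<open>(x', 0)\<close> on
  opposite sides of the origin lie on one orbit if \<open>i x = i x'\<close>. The contact condition says that
  \<open>f x 0\<close> vanishes to order \<open>2 k - 1\<close>, whence \<open>i x = \<plusminus> W x ^ (2 * k)\<close> near \<open>0\<close> for some holomorphic
  \<open>W\<close> with a simple zero, and the half-return map is \<open>W\<^sup>-\<^sup>1 \<circ> (- W)\<close>.
\<close>

section \<open>Separately holomorphic functions on a bidisc\<close>

text \<open>Uniform limits preserve holomorphy but not real analyticity, hence the passage to
  complex arguments: the Picard iterates are holomorphic in the starting abscissa, and so is their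
  limit. The price is that complex objects must be shown to be real on the real axis. For the
  solution this is an invariant of the iteration; for the return point it comes from the real
  intermediate value theorem. The equality \<open>i x = i x'\<close> only makes the two solutions
  meet at abscissa \<open>0\<close>. That the joined graph stays strictly in the half-plane is a
  separate matter: off the origin the sign of \<open>f\<close> along the axis lets a solution
  followed towards \<open>0\<close> cross the axis in one direction only, and at \<open>0\<close>
  itself, where \<open>f\<close> vanishes, the sign of \<open>i x\<close> decides. Uniqueness has
  its own obstacle: a competing orbit may wander anywhere in \<open>D\<close>, while a Lipschitz
  bound is known only near the origin. It is therefore compared with the orbit constructed there,
  and whichever returns first forces the other to return at the same time.\<close>

lemma continuous_on_curried_compose:
  assumes "continuous_on (S \<times> T) (\<lambda>(x, y). f x y)" "continuous_on U a" "continuous_on U b"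
    "\<And>t. t \<in> U \<Longrightarrow> a t \<in> S" "\<And>t. t \<in> U \<Longrightarrow> b t \<in> T"
  shows "continuous_on U (\<lambda>t. f (a t) (b t))"
  using continuous_on_compose2[OF assms(1) continuous_on_Pair[OF assms(2,3)]] assms(4,5)
  by (auto simp: split_beta)

text \<open>Morera's theorem on triangles: Fubini moves the contour integral inside the
  \<open>t\<close>-integral, where Cauchy's theorem for fixed \<open>t\<close> makes it
  vanish.\<close>

lemma holomorphic_on_integral_param:
  fixes g :: "complex \<Rightarrow> real \<Rightarrow> complex"
  assumes S: "open S" and cont: "continuous_on (S \<times> {0..1}) (\<lambda>(z, t). g z t)"
    and hol: "\<And>t. t \<in> {0..1} \<Longrightarrow> (\<lambda>z. g z t) holomorphic_on S"
  shows "(\<lambda>z. integral {0..1} (g z)) holomorphic_on S"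
proof -
  let ?G = "\<lambda>z. integral {0..1} (g z)"
  have contG: "continuous_on S ?G"
    using integral_continuous_on_param[of S 0 "1::real" g] cont by simp
  have seg: "contour_integral (linepath a b) ?G
      = integral {0..1} (\<lambda>t. contour_integral (linepath a b) (\<lambda>z. g z t))"
    if ab: "closed_segment a b \<subseteq> S" for a b
  proof -
    have sub: "linepath a b x \<in> S" if "x \<in> {0..1}" for x
      using ab that by (metis linepath_in_path subsetD)
    have c: "continuous_on (cbox (0, 0) (1, 1)) (\<lambda>(x, t). g (linepath a b x) t * (b - a))"
    proof -
      have "continuous_on ({0..1} \<times> {0..1}) (\<lambda>p. g (linepath a b (fst p)) (snd p) * (b - a))"
        by (intro continuous_intros continuous_on_curried_compose[OF cont]
            continuous_on_compose2[OF continuous_on_linepath]) (use sub in auto)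
      then show ?thesis by (simp add: cbox_Pair_eq split_beta)
    qed
    have "contour_integral (linepath a b) ?G
        = integral {0..1} (\<lambda>x. integral {0..1} (\<lambda>t. g (linepath a b x) t * (b - a)))"
      by (simp add: contour_integral_integral)
    also have "\<dots> = integral {0..1} (\<lambda>t. integral {0..1} (\<lambda>x. g (linepath a b x) t * (b - a)))"
      using integral_swap_continuous[OF c] by simp
    also have "\<dots> = integral {0..1} (\<lambda>t. contour_integral (linepath a b) (\<lambda>z. g z t))"
      by (simp add: contour_integral_integral)
    finally show ?thesis .
  qed
  have int: "(\<lambda>t. contour_integral (linepath a b) (\<lambda>z. g z t)) integrable_on {0..1}"
    if ab: "closed_segment a b \<subseteq> S" for a b
  proof -
    have sub: "linepath a b x \<in> S" if "x \<in> {0..1}" for x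
      using ab that by (metis linepath_in_path subsetD)
    have "continuous_on ({0..1} \<times> {0..1}) (\<lambda>p. g (linepath a b (snd p)) (fst p) * (b - a))"
      by (intro continuous_intros continuous_on_curried_compose[OF cont]
          continuous_on_compose2[OF continuous_on_linepath]) (use sub in auto)
    then have "continuous_on {0..1} (\<lambda>t. integral (cbox 0 1) (\<lambda>x. g (linepath a b x) t * (b - a)))"
      by (intro integral_continuous_on_param) (simp add: split_beta)
    then show ?thesis
      by (simp add: contour_integral_integral integrable_continuous_real)
  qed
  have "?G analytic_on S"
  proof (rule Morera_triangle[OF contG S], intro allI impI)
    fix a b c
    assume sub: "convex hull {a, b, c} \<subseteq> S"
    have s: "closed_segment a b \<subseteq> S" "closed_segment b c \<subseteq> S" "closed_segment c a \<subseteq> S"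
      using order_trans[OF hull_mono sub] by (simp_all add: segment_convex_hull)
    have z: "contour_integral (linepath a b) (\<lambda>z. g z t) + contour_integral (linepath b c) (\<lambda>z. g z t)
        + contour_integral (linepath c a) (\<lambda>z. g z t) = 0" if "t \<in> {0..1}" for t
    proof -
      have h: "(\<lambda>z. g z t) holomorphic_on convex hull {a, b, c}"
        using hol[OF that] sub holomorphic_on_subset by blast
      have i: "(\<lambda>z. g z t) contour_integrable_on linepath x y" if "closed_segment x y \<subseteq> S" for x y
        using hol[OF \<open>t \<in> _\<close>] that
        by (intro contour_integrable_continuous_linepath)
          (meson continuous_on_subset holomorphic_on_imp_continuous_on)
      have "((\<lambda>z. g z t) has_contour_integral 0) (linepath a b +++ linepath b c +++ linepath c a)"
        by (rule Cauchy_theorem_triangle[OF h])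
      then have "contour_integral (linepath a b +++ linepath b c +++ linepath c a) (\<lambda>z. g z t) = 0"
        by (rule contour_integral_unique)
      then show ?thesis using i s by (simp add: add.assoc)
    qed
    have "contour_integral (linepath a b) ?G + contour_integral (linepath b c) ?G
        + contour_integral (linepath c a) ?G
        = integral {0..1} (\<lambda>t. contour_integral (linepath a b) (\<lambda>z. g z t)
            + contour_integral (linepath b c) (\<lambda>z. g z t) + contour_integral (linepath c a) (\<lambda>z. g z t))"
      using int s by (simp add: seg integral_add integrable_add)
    also have "\<dots> = integral {0..1} (\<lambda>t :: real. 0 :: complex)"
      by (rule Henstock_Kurzweil_Integration.integral_cong) (rule z)
    finally show "contour_integral (linepath a b) ?G + contour_integral (linepath b c) ?G
        + contour_integral (linepath c a) ?G = 0" by simp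
  qed
  then show ?thesis by (simp add: analytic_on_open S)
qed

text \<open>Joint continuity is built in because it is what lets separate holomorphy yield
  holomorphy in both variables together (Osgood): Cauchy integrals in one variable can then be
  handled as integrals with a parameter.\<close>

definition holo2 :: "real \<Rightarrow> (complex \<Rightarrow> complex \<Rightarrow> complex) \<Rightarrow> bool" where
  "holo2 r f \<longleftrightarrow> continuous_on (ball 0 r \<times> ball 0 r) (\<lambda>(u, v). f u v) \<and>
     (\<forall>v \<in> ball 0 r. (\<lambda>u. f u v) holomorphic_on ball 0 r) \<and>
     (\<forall>u \<in> ball 0 r. f u holomorphic_on ball 0 r)"

lemma holo2_swap:
  assumes "holo2 r f"
  shows "holo2 r (\<lambda>u v. f v u)"
proof -
  have "continuous_on (ball 0 r \<times> ball 0 r) ((\<lambda>(u, v). f u v) \<circ> prod.swap)"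
    using assms unfolding holo2_def
    by (intro continuous_on_compose continuous_on_swap) (simp add: product_swap)
  then show ?thesis using assms by (auto simp: holo2_def o_def split_beta)
qed

lemma holo2_mono: "holo2 r f \<Longrightarrow> s \<le> r \<Longrightarrow> holo2 s f"
  unfolding holo2_def
  by (meson Sigma_mono continuous_on_subset holomorphic_on_subset subset_ball subsetD)

text \<open>Continuity and differentiability are local, and any two points of the open disc lie in a
  common smaller disc. This serves where a Cauchy integral controls a function only strictly inside
  its contour.\<close>

lemma holo2_localI:
  assumes "\<And>s. 0 < s \<Longrightarrow> s < r \<Longrightarrow> holo2 s f"
  shows "holo2 r f"
proof -
  have mid: "\<exists>s. 0 < s \<and> s < r \<and> u \<in> ball 0 s \<and> v \<in> ball 0 s"
    if "u \<in> ball 0 r" "v \<in> ball 0 r" for u v :: complex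
  proof -
    have "max (norm u) (norm v) < r" using that by simp
    then obtain s where "max (norm u) (norm v) < s" "s < r" using dense by blast
    moreover from this have "0 < s" by (meson max_less_iff_conj norm_ge_zero order_le_less_trans)
    ultimately show ?thesis by auto
  qed
  have "continuous (at p) (\<lambda>(u, v). f u v)" if p: "p \<in> ball 0 r \<times> ball 0 r" for p
  proof -
    obtain s where s: "0 < s" "s < r" "fst p \<in> ball 0 s" "snd p \<in> ball 0 s"
      using mid[of "fst p" "snd p"] p[unfolded mem_Times_iff] by metis
    have "p \<in> ball 0 s \<times> ball 0 s" using s by (simp add: mem_Times_iff)
    moreover have "open (ball 0 s \<times> ball 0 s :: (complex \<times> complex) set)" by (simp add: open_Times)
    moreover have "continuous_on (ball 0 s \<times> ball 0 s) (\<lambda>(u, v). f u v)"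
      using assms[OF s(1,2)] by (simp add: holo2_def)
    ultimately show ?thesis by (simp only: continuous_on_eq_continuous_at)
  qed
  then have "continuous_on (ball 0 r \<times> ball 0 r) (\<lambda>(u, v). f u v)"
    using continuous_at_imp_continuous_on by blast
  moreover have "(\<lambda>u. f u v) holomorphic_on ball 0 r" if w: "v \<in> ball 0 r" for v
    unfolding holomorphic_on_def
  proof
    fix u :: complex
    assume "u \<in> ball 0 r"
    then obtain s where s: "0 < s" "s < r" "u \<in> ball 0 s" "v \<in> ball 0 s"
      using mid w by blast
    then have "(\<lambda>u. f u v) field_differentiable at u"
      using assms[OF s(1,2)] s unfolding holo2_def
      by (intro holomorphic_on_imp_differentiable_at[of _ "ball 0 s"]) auto
    then show "(\<lambda>u. f u v) field_differentiable at u within ball 0 r"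
      by (rule field_differentiable_at_within)
  qed
  moreover have "f u holomorphic_on ball 0 r" if w: "u \<in> ball 0 r" for u
    unfolding holomorphic_on_def
  proof
    fix v :: complex
    assume "v \<in> ball 0 r"
    then obtain s where s: "0 < s" "s < r" "u \<in> ball 0 s" "v \<in> ball 0 s"
      using mid w by blast
    then have "f u field_differentiable at v"
      using assms[OF s(1,2)] s unfolding holo2_def
      by (intro holomorphic_on_imp_differentiable_at[of _ "ball 0 s"]) auto
    then show "f u field_differentiable at v within ball 0 r"
      by (rule field_differentiable_at_within)
  qed
  ultimately show ?thesis by (simp add: holo2_def)
qed

lemma holo2_continuous_compose:
  assumes "holo2 r f" "continuous_on T a" "continuous_on T b"
    "\<And>t. t \<in> T \<Longrightarrow> a t \<in> ball 0 r" "\<And>t. t \<in> T \<Longrightarrow> b t \<in> ball 0 r"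
  shows "continuous_on T (\<lambda>t. f (a t) (b t))"
  using assms continuous_on_curried_compose unfolding holo2_def by blast

section \<open>Closure properties and derivatives of holomorphic functions on a bidisc\<close>

lemma holo2_add:
  assumes "holo2 r f" "holo2 r g"
  shows "holo2 r (\<lambda>u v. f u v + g u v)"
  using assms unfolding holo2_def split_beta
  by (auto intro!: holomorphic_on_add continuous_on_add)

lemma holo2_mult:
  assumes "holo2 r f" "holo2 r g"
  shows "holo2 r (\<lambda>u v. f u v * g u v)"
  using assms unfolding holo2_def split_beta
  by (auto intro!: holomorphic_on_mult continuous_on_mult)

lemma holo2_divide:
  assumes "holo2 r f" "holo2 r g" "\<And>u v. u \<in> ball 0 r \<Longrightarrow> v \<in> ball 0 r \<Longrightarrow> g u v \<noteq> 0"
  shows "holo2 r (\<lambda>u v. f u v / g u v)"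
  using assms unfolding holo2_def split_beta
  by (auto intro!: holomorphic_on_divide continuous_on_divide)

lemma holo2_snd: "holo2 r (\<lambda>u v. v)"
  by (auto simp: holo2_def split_beta intro!: continuous_intros holomorphic_intros)

text \<open>Cauchy's formula on a single circle, independent of \<open>u\<close> and
  \<open>v\<close>, turns the derivative into an integral whose integrand is jointly continuous and
  holomorphic in \<open>u\<close>.\<close>

lemma holo2_deriv_snd:
  assumes f: "holo2 r f"
  shows "holo2 r (\<lambda>u v. deriv (f u) v)"
proof (rule holo2_localI)
  fix s :: real
  assume s: "0 < s" "s < r"
  obtain R where R: "s < R" "R < r" using dense s by blast
  then have R0: "0 < R" using s by linarith
  let ?c = "\<lambda>t::real. of_real R * exp (2 * of_real pi * \<i> * of_real t) :: complex"
  \<comment> \<open>The factor \<open>2 * pi * \<i>\<close> of the circle's velocity is left out; it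
    cancels the constant in Cauchy's formula.\<close>
  define g where "g u v t = f u (?c t) / (?c t - v)\<^sup>2 * ?c t" for u v t
  have cb: "?c t \<in> ball 0 r" for t using R R0 by (simp add: norm_mult)
  have cne: "?c t - v \<noteq> 0" if "v \<in> ball 0 s" for t v
  proof
    assume "?c t - v = 0"
    then have "norm v = norm (?c t)" by simp
    also have "\<dots> = R" using R0 by (simp add: norm_mult)
    finally show False using that R by simp
  qed
  have fu: "f u holomorphic_on ball 0 r" if "u \<in> ball 0 r" for u
    using f that by (simp add: holo2_def)
  have eq: "deriv (f u) v = integral {0..1} (g u v)" if "u \<in> ball 0 s" "v \<in> ball 0 s" for u v
  proof -
    have u: "u \<in> ball 0 r" using that s by simp
    have sub: "cball 0 R \<subseteq> ball 0 r" "ball 0 R \<subseteq> ball 0 r" using R by auto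
    have "(f u has_field_derivative (1 / (2 * of_real pi * \<i>)
        * contour_integral (circlepath 0 R) (\<lambda>w. f u w / (w - v)\<^sup>2))) (at v)"
    proof (rule Cauchy_derivative_integral_circlepath)
      show "continuous_on (cball 0 R) (f u)"
        using fu[OF u] sub holomorphic_on_imp_continuous_on continuous_on_subset by blast
      show "f u holomorphic_on ball 0 R" using fu[OF u] sub holomorphic_on_subset by blast
      show "v \<in> ball 0 R" using that R by simp
    qed
    then have "deriv (f u) v = 1 / (2 * of_real pi * \<i>)
        * contour_integral (circlepath 0 R) (\<lambda>w. f u w / (w - v)\<^sup>2)"
      by (rule DERIV_imp_deriv)
    also have "contour_integral (circlepath 0 R) (\<lambda>w. f u w / (w - v)\<^sup>2)
        = integral {0..1} (\<lambda>t. 2 * of_real pi * \<i> * g u v t)"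
      unfolding contour_integral_integral vector_derivative_circlepath
      by (simp add: circlepath g_def mult_ac)
    also have "\<dots> = 2 * of_real pi * \<i> * integral {0..1} (g u v)" by (rule integral_mult_right)
    finally show ?thesis by simp
  qed
  have contg: "continuous_on ((ball 0 s \<times> ball 0 s) \<times> {0..1}) (\<lambda>(p, t). g (fst p) (snd p) t)"
  proof -
    have "continuous_on ((ball 0 s \<times> ball 0 s) \<times> {0..1 :: real}) (\<lambda>q. f (fst (fst q)) (?c (snd q)))"
      by (rule holo2_continuous_compose[OF f]) (use cb s in \<open>auto intro!: continuous_intros\<close>)
    then show ?thesis
      unfolding g_def split_beta using cne by (auto intro!: continuous_intros)
  qed
  have cont: "continuous_on (ball 0 s \<times> ball 0 s) (\<lambda>(u, v). integral {0..1} (g u v))"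
    using integral_continuous_on_param[of "ball 0 s \<times> ball 0 s" 0 1 "\<lambda>p. g (fst p) (snd p)"] contg
    by (simp add: split_beta)
  have hu: "(\<lambda>u. integral {0..1} (g u v)) holomorphic_on ball 0 s" if v: "v \<in> ball 0 s" for v
  proof (rule holomorphic_on_integral_param)
    show "continuous_on (ball 0 s \<times> {0..1}) (\<lambda>(z, t). g z v t)"
      using continuous_on_curried_compose[OF contg, of "ball 0 s \<times> {0..1}" "\<lambda>q. (fst q, v)" snd] v
      by (simp add: split_beta mem_Times_iff continuous_on_Pair continuous_on_fst continuous_on_snd)
    show "(\<lambda>z. g z v t) holomorphic_on ball 0 s" for t
    proof -
      have "(\<lambda>z. f z (?c t)) holomorphic_on ball 0 r"
        using f cb by (simp add: holo2_def)
      then have "(\<lambda>z. f z (?c t)) holomorphic_on ball 0 s"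
        by (rule holomorphic_on_subset) (use s in auto)
      then show ?thesis unfolding g_def using cne[OF v] by (auto intro!: holomorphic_intros)
    qed
  qed simp
  have hv: "deriv (f u) holomorphic_on ball 0 s" if "u \<in> ball 0 s" for u
  proof -
    have "deriv (f u) holomorphic_on ball 0 r"
      using fu[of u] that s by (auto intro: holomorphic_deriv)
    then show ?thesis by (rule holomorphic_on_subset) (use s in auto)
  qed
  have "continuous_on (ball 0 s \<times> ball 0 s) (\<lambda>(u, v). deriv (f u) v)"
    by (rule continuous_on_eq[OF cont]) (use eq in auto)
  moreover have "(\<lambda>u. deriv (f u) v) holomorphic_on ball 0 s" if "v \<in> ball 0 s" for v
    by (rule holomorphic_transform[OF hu[OF that]]) (use eq that in auto)
  ultimately show "holo2 s (\<lambda>u v. deriv (f u) v)"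
    using hv by (simp add: holo2_def)
qed

lemma holo2_deriv_fst: "holo2 r f \<Longrightarrow> holo2 r (\<lambda>u v. deriv (\<lambda>u. f u v) u)"
  using holo2_swap[OF holo2_deriv_snd[OF holo2_swap]] .

text \<open>Partial derivatives add up to a total one as soon as one of them is jointly continuous;
  here it is the one in \<open>v\<close>, by \<open>holo2_deriv_snd\<close>.\<close>

lemma holo2_has_derivative:
  assumes f: "holo2 r f" and u: "u \<in> ball 0 r" and v: "v \<in> ball 0 r"
  shows "((\<lambda>(u, v). f u v) has_derivative
     (\<lambda>(h, k). deriv (\<lambda>u. f u v) u * h + deriv (f u) v * k)) (at (u, v))"
proof -
  have "((\<lambda>(u, v). f u v) has_derivative
     (\<lambda>(h, k). deriv (\<lambda>u. f u v) u * h + blinfun_mult_right (deriv (f u) v) k))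
      (at (u, v) within ball 0 r \<times> ball 0 r)"
  proof (rule has_derivative_partialsI)
    have "((\<lambda>u. f u v) has_field_derivative deriv (\<lambda>u. f u v) u) (at u)"
      using f u v unfolding holo2_def by (intro holomorphic_derivI[of _ "ball 0 r"]) auto
    then show "((\<lambda>u. f u v) has_derivative (*) (deriv (\<lambda>u. f u v) u)) (at u within ball 0 r)"
      by (meson has_field_derivative_def has_derivative_at_withinI)
    show "(f x has_derivative blinfun_apply (blinfun_mult_right (deriv (f x) y))) (at y within ball 0 r)"
      if "x \<in> ball 0 r" "y \<in> ball 0 r" for x y
    proof -
      have "(f x has_field_derivative deriv (f x) y) (at y)"
        using f that unfolding holo2_def by (intro holomorphic_derivI[of _ "ball 0 r"]) auto
      then show ?thesis
        by (simp add: has_field_derivative_def has_derivative_at_withinI)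
    qed
    have "continuous_on (ball 0 r \<times> ball 0 r) (\<lambda>p. deriv (f (fst p)) (snd p))"
      using holo2_deriv_snd[OF f] by (simp add: holo2_def split_beta)
    then have "continuous_on (ball 0 r \<times> ball 0 r) (\<lambda>p. blinfun_mult_right (deriv (f (fst p)) (snd p)))"
      by (rule bounded_linear.continuous_on[OF bounded_linear_blinfun_mult_right])
    then show "continuous (at (u, v) within ball 0 r \<times> ball 0 r)
        (\<lambda>(x, y). blinfun_mult_right (deriv (f x) y))"
      using u v unfolding continuous_on_eq_continuous_within split_beta by blast
  qed (use v in auto)
  moreover have "at (u, v) within ball 0 r \<times> ball 0 r = at (u, v)"
    using u v by (intro at_within_open) (auto intro: open_Times)
  ultimately show ?thesis by simp
qed

lemma holo2_holomorphic_compose: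
  assumes f: "holo2 r f" and S: "open S" and a: "a holomorphic_on S" and b: "b holomorphic_on S"
    and ar: "\<And>z. z \<in> S \<Longrightarrow> a z \<in> ball 0 r" and br: "\<And>z. z \<in> S \<Longrightarrow> b z \<in> ball 0 r"
  shows "(\<lambda>z. f (a z) (b z)) holomorphic_on S"
proof (rule holomorphic_onI)
  fix z
  assume z: "z \<in> S"
  let ?p = "deriv (\<lambda>u. f u (b z)) (a z)" and ?q = "deriv (f (a z)) (b z)"
  have "((\<lambda>z. (a z, b z)) has_derivative (\<lambda>h. (deriv a z * h, deriv b z * h))) (at z)"
    using holomorphic_derivI[OF a S z] holomorphic_derivI[OF b S z]
    by (intro has_derivative_Pair) (simp_all add: has_field_derivative_def)
  from has_derivative_compose[OF this holo2_has_derivative[OF f ar[OF z] br[OF z]]]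
  have "((\<lambda>z. f (a z) (b z)) has_derivative (\<lambda>h. ?p * (deriv a z * h) + ?q * (deriv b z * h))) (at z)"
    by simp
  also have "(\<lambda>h. ?p * (deriv a z * h) + ?q * (deriv b z * h)) = (*) (?p * deriv a z + ?q * deriv b z)"
    by (auto simp: algebra_simps)
  finally have "((\<lambda>z. f (a z) (b z)) has_field_derivative (?p * deriv a z + ?q * deriv b z)) (at z)"
    by (simp add: has_field_derivative_def)
  then show "(\<lambda>z. f (a z) (b z)) field_differentiable at z within S"
    by (metis field_differentiable_at_within field_differentiable_def)
qed

lemma holo2_Lipschitz_snd:
  assumes f: "holo2 r f" and s: "0 < s" "s < r"
  obtains L where "0 < L"
    "\<And>u v w. u \<in> cball 0 s \<Longrightarrow> v \<in> cball 0 s \<Longrightarrow> w \<in> cball 0 s \<Longrightarrow>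
       norm (f u v - f u w) \<le> L * norm (v - w)"
proof -
  have sub: "cball 0 s \<subseteq> (ball 0 r :: complex set)" using s by auto
  have "continuous_on (cball 0 s \<times> cball 0 s) (\<lambda>p. deriv (f (fst p)) (snd p))"
    using holo2_deriv_snd[OF f] sub
    by (auto simp: holo2_def split_beta elim!: continuous_on_subset)
  then have "compact ((\<lambda>p. deriv (f (fst p)) (snd p)) ` (cball 0 s \<times> cball 0 s))"
    by (intro compact_continuous_image compact_Times) auto
  then obtain L where L: "0 < L" "\<forall>p \<in> cball 0 s \<times> cball 0 s. norm (deriv (f (fst p)) (snd p)) \<le> L"
    using bounded_pos[of "(\<lambda>p. deriv (f (fst p)) (snd p)) ` (cball 0 s \<times> cball 0 s)"]
    by (auto dest!: compact_imp_bounded)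
  have "norm (f u v - f u w) \<le> L * norm (v - w)"
    if u: "u \<in> cball 0 s" and vw: "v \<in> cball 0 s" "w \<in> cball 0 s" for u v w
  proof (rule field_differentiable_bound[OF convex_cball _ _ vw, of "f u" "deriv (f u)"])
    fix z :: complex
    assume z: "z \<in> cball 0 s"
    have "f u holomorphic_on ball 0 r" using f u sub by (auto simp: holo2_def)
    then show "(f u has_field_derivative deriv (f u) z) (at z within cball 0 s)"
      using z sub by (intro holomorphic_derivI[of _ "ball 0 r"]) auto
    show "norm (deriv (f u) z) \<le> L" using L(2) u z by auto
  qed
  with L(1) show ?thesis by (rule that)
qed

section \<open>Iterated Lie derivatives and the order of contact\<close>

definition complexifies ::
    "real \<Rightarrow> (complex \<Rightarrow> complex \<Rightarrow> complex) \<Rightarrow> (real \<times> real \<Rightarrow> real) \<Rightarrow> bool" where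
  "complexifies r G g \<longleftrightarrow> holo2 r G \<and>
     (\<forall>u v. \<bar>u\<bar> < r \<and> \<bar>v\<bar> < r \<longrightarrow> G (of_real u) (of_real v) = of_real (g (u, v)))"

lemma complexifies_mono: "complexifies r G g \<Longrightarrow> s \<le> r \<Longrightarrow> complexifies s G g"
  unfolding complexifies_def using holo2_mono by fastforce

text \<open>The real double series converges absolutely at a positive corner \<open>(r, r)\<close>,
  and its terms there majorise the complex terms on the whole closed bidisc of radius
  \<open>r\<close>. The Weierstrass test does the rest.\<close>

lemma real_analytic_on2_complexify:
  assumes "real_analytic_on2 g S" "(0, 0) \<in> S"
  obtains r G where "0 < r" "complexifies r G g"
proof -
  obtain R c where R: "0 < R" and sum: "\<And>u v. \<bar>u\<bar> < R \<Longrightarrow> \<bar>v\<bar> < R \<Longrightarrow>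
      ((\<lambda>(i, j). c i j * u ^ i * v ^ j) has_sum g (u, v)) UNIV"
    using assms unfolding real_analytic_on2_def by fastforce
  \<comment> \<open>Halving puts the corner \<open>(r, r)\<close> strictly inside the square of
    convergence.\<close>
  define r where "r = R / 2"
  have r: "0 < r" "r < R" using R by (auto simp: r_def)
  define T where "T p u v = of_real (c (fst p) (snd p)) * u ^ fst p * v ^ snd p"
    for p :: "nat \<times> nat" and u v :: complex
  define M where "M p = \<bar>c (fst p) (snd p)\<bar> * r ^ fst p * r ^ snd p" for p :: "nat \<times> nat"
  define G where "G u v = (\<Sum>\<^sub>\<infinity>p. T p u v)" for u v
  have "(\<lambda>(i, j). c i j * r ^ i * r ^ j) summable_on UNIV"
    using sum[of r r] r by (auto simp: summable_on_def)
  then have "(\<lambda>p. norm (case p of (i, j) \<Rightarrow> c i j * r ^ i * r ^ j)) summable_on UNIV"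
    using summable_on_iff_abs_summable_on_real by blast
  also have "(\<lambda>p. norm (case p of (i, j) \<Rightarrow> c i j * r ^ i * r ^ j)) = M"
    using r by (auto simp: M_def abs_mult fun_eq_iff)
  finally have M: "M summable_on UNIV" .
  have TM: "norm (T p u v) \<le> M p" if "norm u \<le> r" "norm v \<le> r" for p u v
    unfolding T_def M_def norm_mult norm_power using that r
    by (auto intro!: mult_mono power_mono)
  \<comment> \<open>The arguments \<open>a\<close> and \<open>b\<close> are left open so that one
    estimate serves the joint limit and the limits with either variable frozen.\<close>
  have lim: "uniform_limit Y (\<lambda>X y. \<Sum>p\<in>X. T p (a y) (b y)) (\<lambda>y. G (a y) (b y))
      (finite_subsets_at_top UNIV)"
    if "\<And>y. y \<in> Y \<Longrightarrow> norm (a y) \<le> r \<and> norm (b y) \<le> r" for Y and a b :: "'a \<Rightarrow> complex"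
    unfolding G_def
    by (rule Weierstrass_m_test_general[OF _ M]) (use that TM in auto)
  have ne: "\<not> trivial_limit (finite_subsets_at_top (UNIV :: (nat \<times> nat) set))" by simp
  have cont: "continuous_on (ball 0 r \<times> ball 0 r) (\<lambda>y. G (fst y) (snd y))"
  proof (rule uniform_limit_theorem[OF _ lim ne])
    show "\<forall>\<^sub>F X in finite_subsets_at_top UNIV.
        continuous_on (ball 0 r \<times> ball 0 r) (\<lambda>y. \<Sum>p\<in>X. T p (fst y) (snd y))"
      by (auto simp: T_def intro!: always_eventually continuous_intros)
  qed auto
  have hu: "(\<lambda>u. G u v) holomorphic_on ball 0 r" if v: "v \<in> ball 0 r" for v
  proof (rule holomorphic_uniform_limit[OF _ lim ne, of 0 r "\<lambda>u. u" "\<lambda>u. v"])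
    show "\<forall>\<^sub>F X in finite_subsets_at_top UNIV. continuous_on (cball 0 r) (\<lambda>y. \<Sum>p\<in>X. T p y v)
        \<and> (\<lambda>y. \<Sum>p\<in>X. T p y v) holomorphic_on ball 0 r"
      by (auto simp: T_def intro!: always_eventually continuous_intros holomorphic_intros)
  qed (use v in auto)
  have hv: "G u holomorphic_on ball 0 r" if u: "u \<in> ball 0 r" for u
  proof (rule holomorphic_uniform_limit[OF _ lim ne, of 0 r "\<lambda>v. u" "\<lambda>v. v"])
    show "\<forall>\<^sub>F X in finite_subsets_at_top UNIV. continuous_on (cball 0 r) (\<lambda>y. \<Sum>p\<in>X. T p u y)
        \<and> (\<lambda>y. \<Sum>p\<in>X. T p u y) holomorphic_on ball 0 r"
      by (auto simp: T_def intro!: always_eventually continuous_intros holomorphic_intros)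
  qed (use u in auto)
  have "G (of_real u) (of_real v) = of_real (g (u, v))" if "\<bar>u\<bar> < r" "\<bar>v\<bar> < r" for u v
  proof -
    have "((\<lambda>(i, j). c i j * u ^ i * v ^ j) has_sum g (u, v)) UNIV"
      using sum[of u v] that r by auto
    then have "((\<lambda>p. of_real (case p of (i, j) \<Rightarrow> c i j * u ^ i * v ^ j)) has_sum
        (of_real (g (u, v)) :: complex)) UNIV"
      by (rule has_sum_of_real)
    also have "(\<lambda>p. of_real (case p of (i, j) \<Rightarrow> c i j * u ^ i * v ^ j)) =
        (\<lambda>p. T p (of_real u) (of_real v))"
      by (auto simp: T_def fun_eq_iff)
    finally show ?thesis unfolding G_def by (rule infsumI)
  qed
  then have "complexifies r G g"
    using cont hu hv by (simp add: complexifies_def holo2_def split_beta)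
  with r(1) show ?thesis by (rule that)
qed

text \<open>On real arguments \<open>G\<close> is the embedded real function \<open>g\<close>. Its
  derivative there therefore equals its own real part, by uniqueness of derivatives, so both complex
  partial derivatives are real.\<close>

lemma complexifies_has_derivative:
  assumes G: "complexifies r G g" and uv: "\<bar>u\<bar> < r" "\<bar>v\<bar> < r"
  obtains a b where "(g has_derivative (\<lambda>(h, k). a * h + b * k)) (at (u, v))"
    "deriv (\<lambda>z. G z (of_real v)) (of_real u) = of_real a"
    "deriv (G (of_real u)) (of_real v) = of_real b"
proof -
  define A where "A = deriv (\<lambda>z. G z (of_real v)) (of_real u)"
  define B where "B = deriv (G (of_real u)) (of_real v)"
  define E where "E = (\<lambda>(h::real, k::real). A * of_real h + B * of_real k)"
  have G2: "holo2 r G" using G by (simp add: complexifies_def)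
  have "((\<lambda>(u, v). G u v) has_derivative (\<lambda>(h, k). A * h + B * k)) (at (of_real u, of_real v))"
    unfolding A_def B_def using uv by (intro holo2_has_derivative[OF G2]) auto
  then have 1: "((\<lambda>(u, v). G u v) has_derivative (\<lambda>(h, k). A * h + B * k))
      (at ((\<lambda>p::real \<times> real. (of_real (fst p), of_real (snd p))) (u, v)))" by simp
  have 2: "((\<lambda>p::real \<times> real. (of_real (fst p), of_real (snd p)) :: complex \<times> complex)
      has_derivative (\<lambda>p. (of_real (fst p), of_real (snd p)))) (at (u, v))"
    by (intro derivative_eq_intros) auto
  have "((\<lambda>p::real \<times> real. G (of_real (fst p)) (of_real (snd p))) has_derivative E)
      (at (u, v))"
    using has_derivative_compose[OF 2 1] by (simp add: E_def case_prod_unfold)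
  moreover have "open {p::real \<times> real. \<bar>fst p\<bar> < r \<and> \<bar>snd p\<bar> < r}"
    by (intro open_Collect_conj open_Collect_less continuous_intros)
  ultimately have d1: "((\<lambda>p. of_real (g p)) has_derivative E) (at (u, v))"
    by (rule has_derivative_transform_within_open) (use G uv in \<open>auto simp: complexifies_def\<close>)
  have dg: "(g has_derivative (\<lambda>p. Re (E p))) (at (u, v))"
    using bounded_linear.has_derivative[OF bounded_linear_Re d1] by simp
  have "((\<lambda>p. of_real (g p)) has_derivative (\<lambda>p. of_real (Re (E p)))) (at (u, v))"
    by (rule has_derivative_of_real[OF dg])
  then have eq: "(\<lambda>p. of_real (Re (E p))) = E" using d1 has_derivative_unique by blast
  have "A = of_real (Re A)" using fun_cong[OF eq, of "(1, 0)"] by (simp add: E_def)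
  moreover have "B = of_real (Re B)" using fun_cong[OF eq, of "(0, 1)"] by (simp add: E_def)
  moreover have "(\<lambda>p. Re (E p)) = (\<lambda>(h, k). Re A * h + Re B * k)"
    by (auto simp: E_def fun_eq_iff)
  ultimately show ?thesis using that dg A_def B_def by metis
qed

definition complex_lie ::
    "(complex \<Rightarrow> complex \<Rightarrow> complex) \<Rightarrow> (complex \<Rightarrow> complex \<Rightarrow> complex) \<Rightarrow>
     (complex \<Rightarrow> complex \<Rightarrow> complex) \<Rightarrow> complex \<Rightarrow> complex \<Rightarrow> complex" where
  "complex_lie X Y G = (\<lambda>u v. X u v * deriv (\<lambda>u. G u v) u + Y u v * deriv (G u) v)"

text \<open>\<open>lie_derivative\<close> rests on \<open>frechet_derivative\<close>, whose value is
  meaningful only where a derivative exists. Carrying a holomorphic extension along guarantees this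
  at each stage of the iteration.\<close>

lemma complexifies_lie_derivative:
  assumes X: "complexifies r X (\<lambda>p. fst (F p))" and Y: "complexifies r Y (\<lambda>p. snd (F p))"
    and G: "complexifies r G g"
  shows "complexifies r (complex_lie X Y G) (lie_derivative F g)"
  unfolding complexifies_def
proof (intro conjI allI impI)
  show "holo2 r (complex_lie X Y G)"
    using X Y G unfolding complexifies_def complex_lie_def
    by (intro holo2_add holo2_mult holo2_deriv_snd holo2_deriv_fst) auto
  fix u v
  assume uv: "\<bar>u\<bar> < r \<and> \<bar>v\<bar> < r"
  obtain a b where ab: "(g has_derivative (\<lambda>(h, k). a * h + b * k)) (at (u, v))"
    "deriv (\<lambda>z. G z (of_real v)) (of_real u) = of_real a"
    "deriv (G (of_real u)) (of_real v) = of_real b"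
    using complexifies_has_derivative[OF G] uv by blast
  show "complex_lie X Y G (of_real u) (of_real v) = of_real (lie_derivative F g (u, v))"
    using X Y uv ab(2,3)
    by (simp add: complex_lie_def lie_derivative_def complexifies_def split_beta mult.commute
        flip: frechet_derivative_at[OF ab(1)])
qed

lemma complexifies_iterated_lie_derivative:
  assumes "complexifies r X (\<lambda>p. fst (F p))" "complexifies r Y (\<lambda>p. snd (F p))"
  shows "complexifies r ((complex_lie X Y ^^ n) (\<lambda>u v. v)) (iterated_lie_derivative F n snd)"
proof (induction n)
  case 0
  then show ?case by (simp add: complexifies_def holo2_snd)
next
  case (Suc n)
  then show ?case using complexifies_lie_derivative[OF assms] by simp
qed

text \<open>\<open>G\<close> plays the role of the iterated Lie derivatives restricted to the line \<open>v = 0\<close>;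
  each derivation lowers the order of vanishing at \<open>0\<close> by exactly one.\<close>

lemma order_of_iterated_derivations:
  assumes r: "0 < r" and x: "x holomorphic_on ball 0 r" and y: "y holomorphic_on ball 0 r"
    and E: "\<And>n. E n holomorphic_on ball 0 r" and m: "2 \<le> m"
    and G1: "\<And>u. u \<in> ball 0 r \<Longrightarrow> G 1 u = y u"
    and Gn: "\<And>n u. 1 \<le> n \<Longrightarrow> u \<in> ball 0 r \<Longrightarrow> G (Suc n) u = x u * deriv (G n) u + y u * E n u"
    and zero: "\<And>i. 1 \<le> i \<Longrightarrow> i < m \<Longrightarrow> G i 0 = 0" and nz: "G m 0 \<noteq> (0 :: complex)"
  shows "x 0 \<noteq> 0 \<and> (\<exists>a \<rho>. 0 < \<rho> \<and> \<rho> \<le> r \<and> a holomorphic_on ball 0 \<rho> \<and>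
    (\<forall>u \<in> ball 0 \<rho>. y u = u ^ (m - 1) * a u) \<and> G m 0 = fact (m - 1) * x 0 ^ (m - 1) * a 0)"
proof -
  obtain m' where m': "m = Suc m'" "1 \<le> m'" using m by (cases m) auto
  have y0: "y 0 = 0" using zero[of 1] G1[of 0] r m by auto
  \<comment> \<open>By the recursion \<open>G m 0\<close> is \<open>x 0\<close> times a derivative,
    since the other summand carries the factor \<open>y 0 = 0\<close>.\<close>
  have x0: "x 0 \<noteq> 0" using nz Gn[of m' 0] y0 r m' by auto
  \<comment> \<open>If \<open>y\<close> vanished identically, the recursion would make all the
    \<open>G n\<close> with \<open>n\<close> at least \<open>1\<close> vanish too, against
    \<open>nz\<close>.\<close>
  have nc: "\<not> y constant_on ball 0 r"
  proof
    assume "y constant_on ball 0 r"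
    then have yz: "y u = 0" if "u \<in> ball 0 r" for u
      using y0 that r unfolding constant_on_def by (metis centre_in_ball)
    have "\<forall>u \<in> ball 0 r. G (Suc n) u = 0" for n
    proof (induction n)
      case 0
      then show ?case using G1 yz by simp
    next
      case (Suc n)
      have "deriv (G (Suc n)) u = 0" if u: "u \<in> ball 0 r" for u
      proof (rule DERIV_imp_deriv)
        have "((\<lambda>u. 0) has_field_derivative 0) (at u)" by simp
        then show "(G (Suc n) has_field_derivative 0) (at u)"
          by (rule has_field_derivative_transform_within_open[of _ _ _ "ball 0 r"])
            (use u Suc in auto)
      qed
      then show ?case using Gn[of "Suc n"] yz by simp
    qed
    then show False using nz r m'(1) by simp
  qed
  have c: "0 \<in> ball (0 :: complex) r" using r by simp
  obtain a \<rho> p where p: "0 < p" and \<rho>: "0 < \<rho>" "ball 0 \<rho> \<subseteq> ball (0 :: complex) r"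
    and a: "a holomorphic_on ball 0 \<rho>" and ya: "\<And>u. u \<in> ball 0 \<rho> \<Longrightarrow> y u = u ^ p * a u"
    and a0: "\<And>u. u \<in> ball 0 \<rho> \<Longrightarrow> a u \<noteq> 0"
    by (rule holomorphic_factor_zero_nonconstant[OF y open_ball connected_ball c y0 nc])
      (rule that, assumption+, unfold diff_zero)
  have \<rho>r: "\<rho> \<le> r" using \<rho> by (simp add: ball_subset_ball_iff)
  \<comment> \<open>Each derivation multiplies the leading coefficient by \<open>x 0\<close> and by
    the current exponent. The falling product of exponents is \<open>fact p / fact (p - n)\<close>,
    written without division.\<close>
  have ex: "\<exists>A. A holomorphic_on ball 0 \<rho> \<and> (\<forall>u \<in> ball 0 \<rho>. G (Suc n) u = u ^ (p - n) * A u) \<and>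
      A 0 * fact (p - n) = fact p * x 0 ^ n * a 0" if "n \<le> p" for n
    using that
  proof (induction n)
    case 0
    then show ?case using a ya G1 \<rho>(2) by (intro exI[of _ a]) auto
  next
    case (Suc n)
    then obtain A where A: "A holomorphic_on ball 0 \<rho>"
      "\<And>u. u \<in> ball 0 \<rho> \<Longrightarrow> G (Suc n) u = u ^ (p - n) * A u"
      "A 0 * fact (p - n) = fact p * x 0 ^ n * a 0" by auto
    define q where "q = p - Suc n"
    have q: "p - n = Suc q" "p = q + Suc n" "p - Suc n = q"
      using Suc.prems by (auto simp: q_def)
    \<comment> \<open>The last summand comes from \<open>y u * E (Suc n) u\<close> after
      \<open>u ^ (p - Suc n)\<close> is taken out of \<open>u ^ p\<close>. It vanishes at
      \<open>0\<close> and so leaves the leading coefficient alone.\<close>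
    define A' where "A' u = x u * (of_nat (Suc q) * A u + u * deriv A u) + u ^ Suc n * a u * E (Suc n) u" for u
    have dG: "deriv (G (Suc n)) u = of_nat (Suc q) * u ^ q * A u + u ^ Suc q * deriv A u"
      if u: "u \<in> ball 0 \<rho>" for u
    proof (rule DERIV_imp_deriv)
      have "(A has_field_derivative deriv A u) (at u)"
        using A(1) u by (intro holomorphic_derivI) auto
      then have "((\<lambda>u. u ^ Suc q * A u) has_field_derivative
          (of_nat (Suc q) * u ^ q * A u + u ^ Suc q * deriv A u)) (at u)"
        by (rule DERIV_cong[OF DERIV_mult[OF DERIV_power_Suc[OF DERIV_ident]]]) (simp add: mult_ac)
      then show "(G (Suc n) has_field_derivative
          (of_nat (Suc q) * u ^ q * A u + u ^ Suc q * deriv A u)) (at u)"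
        by (rule has_field_derivative_transform_within_open[of _ _ _ "ball 0 \<rho>"])
          (use u A(2) q(1) in auto)
    qed
    have "A' holomorphic_on ball 0 \<rho>"
      unfolding A'_def using A(1) a holomorphic_on_subset[OF x \<rho>(2)] holomorphic_on_subset[OF E \<rho>(2)]
      by (intro holomorphic_intros) auto
    moreover have "G (Suc (Suc n)) u = u ^ (p - Suc n) * A' u" if u: "u \<in> ball 0 \<rho>" for u
    proof -
      have "G (Suc (Suc n)) u = x u * (of_nat (Suc q) * u ^ q * A u + u ^ Suc q * deriv A u)
          + u ^ (q + Suc n) * a u * E (Suc n) u"
        using Gn[of "Suc n" u] dG[OF u] ya[OF u] u \<rho>(2) q(2) by auto
      also have "\<dots> = u ^ q * A' u"
        by (simp add: A'_def power_add algebra_simps)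
      finally show ?thesis by (simp add: q)
    qed
    moreover have "A' 0 * fact (p - Suc n) = fact p * x 0 ^ Suc n * a 0"
    proof -
      have "A' 0 * fact (p - Suc n) = x 0 * (A 0 * (of_nat (Suc q) * fact q))"
        by (simp add: A'_def q)
      also have "of_nat (Suc q) * fact q = (fact (p - n) :: complex)" by (simp add: q)
      finally show ?thesis using A(3) by (simp add: algebra_simps)
    qed
    ultimately show ?case by blast
  qed
  have Gp: "G (Suc p) 0 = fact p * x 0 ^ p * a 0"
    using ex[of p] \<rho>(1) by auto
  then have "G (Suc p) 0 \<noteq> 0" using x0 a0 \<rho>(1) by simp
  \<comment> \<open>Both \<open>m\<close> and \<open>Suc p\<close> are the first positive index at
    which \<open>G\<close> does not vanish at \<open>0\<close>.\<close>
  then have "m \<le> Suc p" using zero[of "Suc p"] by (cases "Suc p < m") auto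
  moreover have "\<not> m < Suc p"
  proof
    assume "m < Suc p"
    then have "m' < p" using m' by simp
    then have "G (Suc m') 0 = 0" using ex[of m'] \<rho>(1) by auto
    then show False using nz m' by simp
  qed
  ultimately have "m = Suc p" by simp
  with \<rho> \<rho>r a ya x0 Gp show ?thesis by (intro conjI exI[of _ a] exI[of _ \<rho>]) auto
qed

text \<open>On the line \<open>v = 0\<close> the transversal derivative
  \<open>deriv (C n u) 0\<close> enters the recursion only as a factor of \<open>Y u 0\<close>. It
  can thus be any holomorphic function of \<open>u\<close>, and the recursion becomes one in a
  single variable. The last equation later fixes the sign of the leading coefficient.\<close>

lemma contact_order:
  assumes r: "0 < r" and X: "complexifies r X (\<lambda>p. fst (F p))" and Y: "complexifies r Y (\<lambda>p. snd (F p))"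
    and m: "2 \<le> m" and contact: "contact_of_multiplicity F m"
  obtains a \<rho> where "0 < \<rho>" "\<rho> \<le> r" "a holomorphic_on ball 0 \<rho>"
    "\<And>u. u \<in> ball 0 \<rho> \<Longrightarrow> Y u 0 = u ^ (m - 1) * a u"
    "X 0 0 \<noteq> 0" "of_real (iterated_lie_derivative F m snd (0, 0)) = fact (m - 1) * X 0 0 ^ (m - 1) * a 0"
proof -
  define C where "C n = (complex_lie X Y ^^ n) (\<lambda>u v. v)" for n
  have C: "complexifies r (C n) (iterated_lie_derivative F n snd)" for n
    unfolding C_def by (rule complexifies_iterated_lie_derivative[OF X Y])
  have C0: "C n 0 0 = of_real (iterated_lie_derivative F n snd (0, 0))" for n
    using C[of n] r unfolding complexifies_def by (metis abs_zero of_real_0)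
  have h: "(\<lambda>u. H u 0) holomorphic_on ball 0 r" if "complexifies r H h" for H h
    using that r by (simp add: complexifies_def holo2_def)
  have 1: "(\<lambda>u. deriv (C n u) 0) holomorphic_on ball 0 r" for n
    using holo2_deriv_snd[of r "C n"] C[of n] r by (simp add: complexifies_def holo2_def)
  have 2: "C 1 u 0 = Y u 0" for u
    by (simp add: C_def complex_lie_def)
  have 3: "C (Suc n) u 0 = X u 0 * deriv (\<lambda>u. C n u 0) u + Y u 0 * deriv (C n u) 0" for n u
    by (simp add: C_def complex_lie_def)
  have 4: "C i 0 0 = 0" if "1 \<le> i" "i < m" for i
    using contact that by (simp add: C0 contact_of_multiplicity_def)
  have 5: "C m 0 0 \<noteq> 0"
    using contact by (simp add: C0 contact_of_multiplicity_def)
  obtain a \<rho> where "X 0 0 \<noteq> 0" "0 < \<rho>" "\<rho> \<le> r" "a holomorphic_on ball 0 \<rho>"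
    "\<forall>u \<in> ball 0 \<rho>. Y u 0 = u ^ (m - 1) * a u" "C m 0 0 = fact (m - 1) * X 0 0 ^ (m - 1) * a 0"
    using order_of_iterated_derivations[where G = "\<lambda>n u. C n u 0", OF r h[OF X] h[OF Y] 1 m 2 3 _ 5] 4
    by blast
  then show ?thesis by (intro that[of \<rho> a]) (auto simp flip: C0)
qed

section \<open>The graph equation with holomorphic parameter\<close>

lemma integral_rescale_unit_interval:
  fixes q :: "real \<Rightarrow> 'a :: euclidean_space"
  assumes "0 \<le> s" "continuous_on {0..s} q"
  shows "s *\<^sub>R integral {0..1} (\<lambda>t. q (s * t)) = integral {0..s} q"
proof -
  have "((\<lambda>t. s *\<^sub>R q (s * t)) has_integral integral {s * 0..s * 1} q) {0..1}"
    by (rule has_integral_substitution[where c = 0 and d = s])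
      (use assms in \<open>auto intro!: derivative_eq_intros mult_left_le\<close>)
  then show ?thesis by (auto dest: integral_unique)
qed

text \<open>The Picard iteration for \<open>dz/dt = - x * f (x * (1 - t)) z\<close>, \<open>z 0 = 0\<close>: the equation
  \<open>dy/d\<xi> = f \<xi> y\<close>, \<open>y x = 0\<close> transported to \<open>0 \<le> t \<le> 1\<close> by \<open>\<xi> = x * (1 - t)\<close>, so that the
  initial point \<open>x\<close> becomes a parameter on which the solution depends holomorphically.\<close>

locale graph_equation =
  fixes f :: "complex \<Rightarrow> complex \<Rightarrow> complex" and R r M L \<delta> :: real
  assumes holo: "holo2 R f" and r: "0 < r" "r < R"
    and bound: "\<And>u v. u \<in> cball 0 r \<Longrightarrow> v \<in> cball 0 r \<Longrightarrow> norm (f u v) \<le> M"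
    and lipschitz: "\<And>u v w. u \<in> cball 0 r \<Longrightarrow> v \<in> cball 0 r \<Longrightarrow> w \<in> cball 0 r \<Longrightarrow>
      norm (f u v - f u w) \<le> L * norm (v - w)"
    and \<delta>: "0 < \<delta>" "\<delta> \<le> r" "\<delta> * M < r" "\<delta> * L \<le> 1 / 2" and L: "0 \<le> L"
    and real_f: "\<And>u v. u \<in> \<real> \<Longrightarrow> v \<in> \<real> \<Longrightarrow> u \<in> ball 0 r \<Longrightarrow> v \<in> ball 0 r \<Longrightarrow> f u v \<in> \<real>"
begin

text \<open>These properties are preserved by Picard's map and survive uniform limits. The last
  clause is what lets the complex solution be read as a solution of the real equation.\<close>

definition admissible :: "(real \<Rightarrow> complex \<Rightarrow> complex) \<Rightarrow> bool" where
  "admissible z \<longleftrightarrow> continuous_on ({0..1} \<times> ball 0 \<delta>) (\<lambda>(s, x). z s x) \<and>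
     (\<forall>s \<in> {0..1}. z s holomorphic_on ball 0 \<delta>) \<and>
     (\<forall>s \<in> {0..1}. \<forall>x \<in> ball 0 \<delta>. norm (z s x) \<le> \<delta> * M) \<and>
     (\<forall>s \<in> {0..1}. \<forall>x \<in> ball 0 \<delta> \<inter> \<real>. z s x \<in> \<real>)"

text \<open>The integral from \<open>0\<close> to \<open>s\<close> is rescaled to the unit interval,
  so that \<open>s\<close> and \<open>x\<close> occur only inside the integrand and the results on
  integrals with a parameter apply.\<close>

definition picard :: "(real \<Rightarrow> complex \<Rightarrow> complex) \<Rightarrow> real \<Rightarrow> complex \<Rightarrow> complex" where
  "picard z s x = - x * of_real s *
     integral {0..1} (\<lambda>t. f (x * of_real (1 - s * t)) (z (s * t) x))"

section \<open>Picard's map preserves admissibility and is a contraction\<close>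

lemma M_nonneg: "0 \<le> M"
  using bound[of 0 0] r by (meson centre_in_cball less_imp_le norm_ge_zero order_trans)

lemma unit_mult: "s * t \<in> {0..1}" if "s \<in> {0..1}" "t \<in> {0..1}" for s t :: real
  using that by (auto simp: mult_le_one)

lemma base_in_ball: "x * of_real (1 - t) \<in> ball 0 \<delta>" if "x \<in> ball 0 \<delta>" "t \<in> {0..1}"
  for x :: complex
proof -
  have "norm x * \<bar>1 - t\<bar> \<le> norm x * 1" using that by (intro mult_left_mono) auto
  moreover have "norm (x * of_real (1 - t)) = norm x * \<bar>1 - t\<bar>"
    by (simp only: norm_mult norm_of_real)
  ultimately show ?thesis using that by simp
qed

lemma base_in_ball_r: "x * of_real (1 - t) \<in> ball 0 r" if "x \<in> ball 0 \<delta>" "t \<in> {0..1}"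
  for x :: complex
  using base_in_ball[OF that] \<delta>(2) by auto

lemma admissible_in_ball: "z s x \<in> ball 0 r" if "admissible z" "s \<in> {0..1}" "x \<in> ball 0 \<delta>"
  using that \<delta>(3) unfolding admissible_def by fastforce

lemma holo_r: "holo2 r f" using holo2_mono[OF holo] r by simp

lemma admissible_integrand_continuous:
  assumes z: "admissible z" and ab: "continuous_on T a" "continuous_on T b"
    and T: "\<And>p. p \<in> T \<Longrightarrow> a p \<in> {0..1} \<and> b p \<in> ball 0 \<delta>"
  shows "continuous_on T (\<lambda>p. f (b p * of_real (1 - a p)) (z (a p) (b p)))"
proof (rule holo2_continuous_compose[OF holo_r])
  show "continuous_on T (\<lambda>p. z (a p) (b p))"
    using z ab T by (intro continuous_on_curried_compose[of "{0..1}" "ball 0 \<delta>" z])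
      (auto simp: admissible_def)
  show "b p * of_real (1 - a p) \<in> ball 0 r" "z (a p) (b p) \<in> ball 0 r" if "p \<in> T" for p
    using T[OF that] base_in_ball_r admissible_in_ball[OF z] by auto
qed (intro continuous_intros ab)

lemma picard_norm:
  assumes z: "admissible z" and s: "s \<in> {0..1}" and x: "x \<in> ball 0 \<delta>"
  shows "norm (picard z s x) \<le> \<delta> * M"
proof -
  have "norm (integral {0..1} (\<lambda>t. f (x * of_real (1 - s * t)) (z (s * t) x))) \<le> M * (1 - 0)"
  proof (rule integral_bound)
    show "continuous_on {0..1} (\<lambda>t. f (x * of_real (1 - s * t)) (z (s * t) x))"
      using s x unit_mult by (intro admissible_integrand_continuous[OF z] continuous_intros) auto
    show "norm (f (x * of_real (1 - s * t)) (z (s * t) x)) \<le> M" if "t \<in> {0..1}" for t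
      using base_in_ball_r[OF x unit_mult[OF s that]] admissible_in_ball[OF z unit_mult[OF s that] x]
      by (intro bound) auto
  qed simp
  then have "norm x * \<bar>s\<bar> * norm (integral {0..1} (\<lambda>t. f (x * of_real (1 - s * t)) (z (s * t) x)))
      \<le> (\<delta> * 1) * M"
    using s x \<delta> M_nonneg by (intro mult_mono) auto
  then show ?thesis by (simp add: picard_def norm_mult)
qed

lemma picard_admissible:
  assumes z: "admissible z"
  shows "admissible (picard z)"
  unfolding admissible_def
proof (intro conjI ballI)
  have "continuous_on (({0..1} \<times> ball 0 \<delta>) \<times> cbox 0 1)
      (\<lambda>p. f (snd (fst p) * of_real (1 - fst (fst p) * snd p)) (z (fst (fst p) * snd p) (snd (fst p))))"
    using unit_mult by (intro admissible_integrand_continuous[OF z] continuous_intros) auto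
  then have "continuous_on ({0..1} \<times> ball 0 \<delta>)
      (\<lambda>p. integral (cbox 0 1) (\<lambda>t. f (snd p * of_real (1 - fst p * t)) (z (fst p * t) (snd p))))"
    by (intro integral_continuous_on_param) (simp add: split_beta)
  then show "continuous_on ({0..1} \<times> ball 0 \<delta>) (\<lambda>(s, x). picard z s x)"
    unfolding picard_def split_beta by (intro continuous_intros) simp
next
  fix s :: real
  assume s: "s \<in> {0..1}"
  have "(\<lambda>x. integral {0..1} (\<lambda>t. f (x * of_real (1 - s * t)) (z (s * t) x))) holomorphic_on ball 0 \<delta>"
  proof (rule holomorphic_on_integral_param)
    show "continuous_on (ball 0 \<delta> \<times> {0..1}) (\<lambda>(x, t). f (x * of_real (1 - s * t)) (z (s * t) x))"
      unfolding split_beta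
      using s unit_mult by (intro admissible_integrand_continuous[OF z] continuous_intros) auto
    fix t :: real
    assume "t \<in> {0..1}"
    then have st: "s * t \<in> {0..1}" using s unit_mult by blast
    show "(\<lambda>x. f (x * of_real (1 - s * t)) (z (s * t) x)) holomorphic_on ball 0 \<delta>"
    proof (rule holo2_holomorphic_compose[OF holo_r])
      show "z (s * t) holomorphic_on ball 0 \<delta>" using z st by (simp add: admissible_def)
    qed (use base_in_ball_r[OF _ st] admissible_in_ball[OF z st] in \<open>auto intro!: holomorphic_intros\<close>)
  qed simp
  then show "picard z s holomorphic_on ball 0 \<delta>"
    unfolding picard_def by (intro holomorphic_intros)
next
  fix s :: real and x :: complex
  assume s: "s \<in> {0..1}"
  show "norm (picard z s x) \<le> \<delta> * M" if "x \<in> ball 0 \<delta>"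
    using picard_norm[OF z s that] .
  assume x: "x \<in> ball 0 \<delta> \<inter> \<real>"
  let ?h = "\<lambda>t. f (x * of_real (1 - s * t)) (z (s * t) x)"
  have "Im (?h t) = 0" if "t \<in> {0..1}" for t
  proof -
    note st = unit_mult[OF s that]
    have "z (s * t) x \<in> \<real>" using z st x by (simp add: admissible_def)
    then have "?h t \<in> \<real>"
      using x base_in_ball_r[OF _ st, of x] admissible_in_ball[OF z st, of x]
      by (intro real_f Reals_mult) auto
    then show ?thesis by (simp add: complex_is_Real_iff)
  qed
  then have "integral {0..1} (Im \<circ> ?h) = integral {0..1} (\<lambda>t :: real. 0)"
    by (intro Henstock_Kurzweil_Integration.integral_cong) auto
  moreover have "integral {0..1} (Im \<circ> ?h) = Im (integral {0..1} ?h)"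
    using s x unit_mult
    by (intro integral_linear bounded_linear_Im integrable_continuous_real
        admissible_integrand_continuous[OF z] continuous_intros) auto
  ultimately have "integral {0..1} ?h \<in> \<real>" by (simp add: complex_is_Real_iff)
  then show "picard z s x \<in> \<real>"
    using x unfolding picard_def by (intro Reals_mult Reals_minus) auto
qed

text \<open>The bound is taken over \<open>s\<close> with \<open>x\<close> fixed, because
  \<open>picard z s x\<close> uses \<open>z\<close> at the same \<open>x\<close> only. The factor is
  at most \<open>norm x * L\<close>, hence at most \<open>1 / 2\<close>.\<close>

lemma picard_contraction:
  assumes z: "admissible z" and w: "admissible w" and s: "s \<in> {0..1}" and x: "x \<in> ball 0 \<delta>"
    and e: "\<And>s. s \<in> {0..1} \<Longrightarrow> norm (z s x - w s x) \<le> e"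
  shows "norm (picard z s x - picard w s x) \<le> e / 2"
proof -
  let ?h = "\<lambda>z t. f (x * of_real (1 - s * t)) (z (s * t) x)"
  have c: "continuous_on {0..1} (?h z)" if "admissible z" for z
    using s x unit_mult by (intro admissible_integrand_continuous[OF that] continuous_intros) auto
  have e0: "0 \<le> e" using e[OF s] norm_ge_zero order_trans by blast
  have "norm (integral {0..1} (\<lambda>t. ?h z t - ?h w t)) \<le> (L * e) * (1 - 0)"
  proof (rule integral_bound)
    show "continuous_on {0..1} (\<lambda>t. ?h z t - ?h w t)" by (intro continuous_intros c z w)
    fix t :: real
    assume t: "t \<in> {0..1}"
    note st = unit_mult[OF s t]
    have "norm (?h z t - ?h w t) \<le> L * norm (z (s * t) x - w (s * t) x)"
      using base_in_ball_r[OF x st] admissible_in_ball[OF z st x] admissible_in_ball[OF w st x]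
      by (intro lipschitz) auto
    also have "\<dots> \<le> L * e" using e[OF st] L by (intro mult_left_mono)
    finally show "norm (?h z t - ?h w t) \<le> L * e" .
  qed simp
  then have "norm x * \<bar>s\<bar> * norm (integral {0..1} (\<lambda>t. ?h z t - ?h w t)) \<le> (\<delta> * 1) * (L * e)"
    using s x \<delta> e0 L by (intro mult_mono) auto
  also have "\<dots> \<le> (1 / 2) * e" using mult_right_mono[OF \<delta>(4) e0] by (simp add: mult_ac)
  finally have *: "norm (x * of_real s * integral {0..1} (\<lambda>t. ?h z t - ?h w t)) \<le> e / 2"
    by (simp add: norm_mult)
  have "integral {0..1} (\<lambda>t. ?h z t - ?h w t) = integral {0..1} (?h z) - integral {0..1} (?h w)"
    by (intro integral_diff integrable_continuous_real c z w)
  then have "picard z s x - picard w s x = - (x * of_real s * integral {0..1} (\<lambda>t. ?h z t - ?h w t))"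
    by (simp only: picard_def) (simp add: algebra_simps)
  then show ?thesis using * by simp
qed

lemma admissible_zero: "admissible (\<lambda>s x. 0)"
  using \<delta> M_nonneg by (simp add: admissible_def split_beta)

text \<open>The limit of the iterates, as a telescoping series: its terms shrink geometrically,
  which makes the convergence uniform by the Weierstrass test.\<close>

definition solution :: "real \<Rightarrow> complex \<Rightarrow> complex" where
  "solution s x = (\<Sum>n. (picard ^^ Suc n) (\<lambda>s x. 0) s x - (picard ^^ n) (\<lambda>s x. 0) s x)"

lemma iterates_admissible: "admissible ((picard ^^ n) (\<lambda>s x. 0))"
  by (induction n) (auto simp: admissible_zero picard_admissible)

lemma solution_uniform_limit:
  "uniform_limit ({0..1} \<times> ball 0 \<delta>) (\<lambda>n p. (picard ^^ n) (\<lambda>s x. 0) (fst p) (snd p))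
    (\<lambda>p. solution (fst p) (snd p)) sequentially"
proof -
  let ?Z = "\<lambda>n. (picard ^^ n) (\<lambda>s x. 0)"
  have step: "\<forall>s \<in> {0..1}. norm (?Z (Suc n) s x - ?Z n s x) \<le> r * (1 / 2) ^ n"
    if x: "x \<in> ball 0 \<delta>" for n x
  proof (induction n)
    case 0
    show ?case using picard_norm[OF admissible_zero _ x] \<delta>(3) by fastforce
  next
    case (Suc n)
    show ?case
    proof
      fix s :: real
      assume "s \<in> {0..1}"
      from picard_contraction[OF iterates_admissible iterates_admissible this x, of "Suc n" n] Suc
      show "norm (?Z (Suc (Suc n)) s x - ?Z (Suc n) s x) \<le> r * (1 / 2) ^ Suc n"
        by simp
    qed
  qed
  have "uniform_limit ({0..1} \<times> ball 0 \<delta>)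
      (\<lambda>n p. \<Sum>i<n. ?Z (Suc i) (fst p) (snd p) - ?Z i (fst p) (snd p))
      (\<lambda>p. \<Sum>i. ?Z (Suc i) (fst p) (snd p) - ?Z i (fst p) (snd p)) sequentially"
  proof (rule Weierstrass_m_test)
    show "summable (\<lambda>n. r * (1 / 2) ^ n)" by (intro summable_mult summable_geometric) auto
  qed (use step in auto)
  then show ?thesis
    unfolding solution_def by (subst (asm) sum_lessThan_telescope) simp
qed

lemma solution_admissible: "admissible solution"
proof -
  let ?Z = "\<lambda>n. (picard ^^ n) (\<lambda>s x. 0)"
  have lim: "(\<lambda>n. ?Z n s x) \<longlonglongrightarrow> solution s x" if "s \<in> {0..1}" "x \<in> ball 0 \<delta>" for s x
    using tendsto_uniform_limitI[OF solution_uniform_limit, of "(s, x)"] that by simp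
  have cont: "continuous_on ({0..1} \<times> ball 0 \<delta>) (\<lambda>(s, x). solution s x)"
    unfolding split_beta
  proof (rule uniform_limit_theorem[OF _ solution_uniform_limit])
    show "\<forall>\<^sub>F n in sequentially. continuous_on ({0..1} \<times> ball 0 \<delta>) (\<lambda>p. ?Z n (fst p) (snd p))"
      using iterates_admissible by (simp add: admissible_def split_beta)
  qed simp
  have hol: "solution s holomorphic_on ball 0 \<delta>" if s: "s \<in> {0..1}" for s
  proof (rule holomorphic_uniform_sequence[where f = "\<lambda>n. ?Z n s"])
    show "?Z n s holomorphic_on ball 0 \<delta>" for n
      using iterates_admissible s by (simp add: admissible_def)
    fix x :: complex
    assume "x \<in> ball 0 \<delta>"
    then obtain d where d: "0 < d" "cball x d \<subseteq> ball 0 \<delta>"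
      using open_contains_cball by blast
    then have pi: "Pair s \<in> cball x d \<rightarrow> {0..1} \<times> ball 0 \<delta>" using s by blast
    have "uniform_limit (cball x d) (\<lambda>n. ?Z n s) (solution s) sequentially"
      using uniform_limit_compose'[OF solution_uniform_limit pi] by simp
    with d show "\<exists>d>0. cball x d \<subseteq> ball 0 \<delta> \<and> uniform_limit (cball x d) (\<lambda>n. ?Z n s) (solution s) sequentially"
      by blast
  qed simp
  have nrm: "norm (solution s x) \<le> \<delta> * M" if "s \<in> {0..1}" "x \<in> ball 0 \<delta>" for s x
    using lim[OF that] iterates_admissible that
    by (intro Lim_norm_ubound[OF _ lim[OF that]]) (auto simp: admissible_def)
  have re: "solution s x \<in> \<real>" if "s \<in> {0..1}" "x \<in> ball 0 \<delta> \<inter> \<real>" for s x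
  proof (rule Lim_in_closed_set[OF closed_complex_Reals _ _ lim])
    show "\<forall>\<^sub>F n in sequentially. ?Z n s x \<in> \<real>"
      using iterates_admissible that by (simp add: admissible_def)
  qed (use that in auto)
  show ?thesis using cont hol nrm re by (simp add: admissible_def)
qed

lemma solution_fixpoint:
  assumes s: "s \<in> {0..1}" and x: "x \<in> ball 0 \<delta>"
  shows "picard solution s x = solution s x"
proof (rule ccontr)
  assume "picard solution s x \<noteq> solution s x"
  let ?Z = "\<lambda>n. (picard ^^ n) (\<lambda>s x. 0)"
  let ?d = "norm (picard solution s x - solution s x)"
  \<comment> \<open>Contraction and convergence together bound the gap \<open>?d = 3 * e\<close> by
    \<open>e / 2 + e\<close>, half of itself.\<close>
  define e where "e = ?d / 3"
  have e: "0 < e" using \<open>_ \<noteq> _\<close> by (simp add: e_def)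
  from uniform_limitD[OF solution_uniform_limit e] obtain N where
    N: "\<And>n p. N \<le> n \<Longrightarrow> p \<in> {0..1} \<times> ball 0 \<delta> \<Longrightarrow> dist (?Z n (fst p) (snd p)) (solution (fst p) (snd p)) < e"
    unfolding eventually_sequentially by blast
  have N': "norm (?Z n s x - solution s x) \<le> e" if "N \<le> n" "s \<in> {0..1}" for n s
    using N[of n "(s, x)"] that x by (auto simp: dist_norm)
  have "norm (picard (?Z N) s x - picard solution s x) \<le> e / 2"
    using picard_contraction[OF iterates_admissible solution_admissible s x N'] by simp
  moreover have "norm (picard (?Z N) s x - solution s x) \<le> e"
    using N'[of "Suc N" s] s by simp
  ultimately have "?d \<le> e / 2 + e"
    using norm_triangle_le_diff[of "picard (?Z N) s x - solution s x" "picard (?Z N) s x - picard solution s x"]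
    by (simp add: algebra_simps) (smt (verit) norm_minus_commute)
  then show False using e by (simp add: e_def)
qed

section \<open>The integral equation, the differential equation and the growth of the
  solution\<close>

lemma solution_integrand_continuous:
  assumes "x \<in> ball 0 \<delta>"
  shows "continuous_on {0..1} (\<lambda>t. f (x * of_real (1 - t)) (solution t x))"
  using assms by (intro admissible_integrand_continuous[OF solution_admissible] continuous_intros) auto

lemma solution_eq:
  assumes s: "s \<in> {0..1}" and x: "x \<in> ball 0 \<delta>"
  shows "solution s x = - x * integral {0..s} (\<lambda>t. f (x * of_real (1 - t)) (solution t x))"
proof -
  have "continuous_on {0..s} (\<lambda>t. f (x * of_real (1 - t)) (solution t x))"
    using solution_integrand_continuous[OF x] by (rule continuous_on_subset) (use s in auto)
  then have "integral {0..s} (\<lambda>t. f (x * of_real (1 - t)) (solution t x)) =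
      s *\<^sub>R integral {0..1} (\<lambda>t. f (x * of_real (1 - s * t)) (solution (s * t) x))"
    using integral_rescale_unit_interval[of s "\<lambda>t. f (x * of_real (1 - t)) (solution t x)"] s by simp
  then show ?thesis
    using solution_fixpoint[OF assms, symmetric] by (simp add: picard_def scaleR_conv_of_real mult.assoc)
qed

lemma solution_has_vector_derivative:
  assumes s: "s \<in> {0..1}" and x: "x \<in> ball 0 \<delta>"
  shows "((\<lambda>s. solution s x) has_vector_derivative - x * f (x * of_real (1 - s)) (solution s x))
    (at s within {0..1})"
proof -
  have "((\<lambda>s. integral {0..s} (\<lambda>t. f (x * of_real (1 - t)) (solution t x))) has_vector_derivative
      f (x * of_real (1 - s)) (solution s x)) (at s within {0..1})"
    by (rule integral_has_vector_derivative[OF solution_integrand_continuous[OF x] s])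
  then have "((\<lambda>s. - x * integral {0..s} (\<lambda>t. f (x * of_real (1 - t)) (solution t x))) has_vector_derivative
      - x * f (x * of_real (1 - s)) (solution s x)) (at s within {0..1})"
    by (rule has_vector_derivative_mult_right)
  then show ?thesis
    by (rule has_vector_derivative_transform[rotated 2]) (use s x solution_eq in auto)
qed

lemma solution_0: "x \<in> ball 0 \<delta> \<Longrightarrow> solution 0 x = 0"
  using solution_eq[of 0 x] by simp

text \<open>At a time of maximal norm \<open>m\<close> the integral equation gives
  \<open>m \<le> norm x * (C * norm x ^ p + L * m)\<close>. Since \<open>norm x * L\<close> is at
  most \<open>1 / 2\<close>, the term in \<open>m\<close> is absorbed on the left, which produces
  the factor \<open>2\<close>.\<close>

lemma solution_norm_le:
  assumes x: "x \<in> ball 0 \<delta>" and fC: "\<And>u. u \<in> ball 0 \<delta> \<Longrightarrow> norm (f u 0) \<le> C * norm u ^ p"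
    and C: "0 \<le> C" and s: "s \<in> {0..1}"
  shows "norm (solution s x) \<le> 2 * C * norm x ^ Suc p"
proof -
  have "continuous_on ({0..1} \<times> ball 0 \<delta>) (\<lambda>(s, x). solution s x)"
    using solution_admissible by (simp add: admissible_def)
  then have "continuous_on {0..1} (\<lambda>s. solution s x)"
    using x by (intro continuous_on_curried_compose[of "{0..1}" "ball 0 \<delta>" solution] continuous_intros) auto
  then have "continuous_on {0..1} (\<lambda>s. norm (solution s x))" by (intro continuous_intros)
  from continuous_attains_sup[OF compact_Icc _ this] obtain s0 where
    s0: "s0 \<in> {0..1}" "\<And>s. s \<in> {0..1} \<Longrightarrow> norm (solution s x) \<le> norm (solution s0 x)"
    by auto
  define m where "m = norm (solution s0 x)"
  have "norm (integral {0..s0} (\<lambda>t. f (x * of_real (1 - t)) (solution t x)))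
      \<le> (C * norm x ^ p + L * m) * (s0 - 0)"
  proof (rule integral_bound)
    show "continuous_on {0..s0} (\<lambda>t. f (x * of_real (1 - t)) (solution t x))"
      using solution_integrand_continuous[OF x] by (rule continuous_on_subset) (use s0 in auto)
    fix t
    assume "t \<in> {0..s0}"
    then have t: "t \<in> {0..1}" using s0 by auto
    let ?u = "x * of_real (1 - t)"
    have "norm (f ?u (solution t x) - f ?u 0) \<le> L * norm (solution t x - 0)"
      using base_in_ball_r[OF x t] admissible_in_ball[OF solution_admissible t x] r
      by (intro lipschitz) auto
    also have "\<dots> \<le> L * m" using s0(2)[OF t] L by (simp add: m_def mult_left_mono)
    finally have 1: "norm (f ?u (solution t x) - f ?u 0) \<le> L * m" .
    have "norm ?u \<le> norm x"
      using t by (simp only: norm_mult norm_of_real) (intro mult_left_le, auto)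
    then have "C * norm ?u ^ p \<le> C * norm x ^ p"
      using C by (intro mult_left_mono power_mono) auto
    with fC[OF base_in_ball[OF x t]] have 2: "norm (f ?u 0) \<le> C * norm x ^ p" by linarith
    show "norm (f ?u (solution t x)) \<le> C * norm x ^ p + L * m"
      using norm_triangle_ineq[of "f ?u (solution t x) - f ?u 0" "f ?u 0"] 1 2 by simp
  qed (use s0 in auto)
  also have "\<dots> \<le> (C * norm x ^ p + L * m) * 1"
    using s0 C L by (intro mult_left_mono) (auto simp: m_def)
  finally have "norm x * norm (integral {0..s0} (\<lambda>t. f (x * of_real (1 - t)) (solution t x)))
      \<le> norm x * (C * norm x ^ p + L * m)" by (intro mult_left_mono) auto
  then have "m \<le> C * norm x ^ Suc p + (norm x * L) * m"
    using solution_eq[OF s0(1) x] by (simp add: m_def norm_mult algebra_simps)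
  also have "(norm x * L) * m \<le> (1 / 2) * m"
  proof (rule mult_right_mono)
    have "norm x * L \<le> \<delta> * L" using x L by (intro mult_right_mono) auto
    then show "norm x * L \<le> 1 / 2" using \<delta>(4) by simp
  qed (simp add: m_def)
  finally have "m \<le> 2 * C * norm x ^ Suc p" by simp
  with s0(2)[OF s] show ?thesis by (simp add: m_def)
qed

lemma integral_one_minus_power:
  "integral {0..1} (\<lambda>t. c * (x * of_real (1 - t)) ^ p) = (c * x ^ p / of_nat (Suc p) :: complex)"
proof -
  have "((\<lambda>t. c * (x * of_real (1 - t)) ^ p) has_integral
      (- (c * x ^ p * of_real ((1 - 1) ^ Suc p / real (Suc p))) - (- (c * x ^ p * of_real ((1 - 0) ^ Suc p / real (Suc p))))))
      {0..1}"
  proof (rule fundamental_theorem_of_calculus)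
    fix t :: real
    have "((\<lambda>t. (1 - t) ^ Suc p / real (Suc p)) has_field_derivative - ((1 - t) ^ p)) (at t within {0..1})"
      by (rule DERIV_cong[OF DERIV_cdivide[OF DERIV_power_Suc[of _ "-1"]]])
        (auto intro!: derivative_eq_intros simp: field_simps)
    then have "((\<lambda>t. of_real ((1 - t) ^ Suc p / real (Suc p)) :: complex) has_vector_derivative of_real (- ((1 - t) ^ p)))
        (at t within {0..1})"
      by (rule has_vector_derivative_of_real)
    then have "((\<lambda>t. - (c * x ^ p * of_real ((1 - t) ^ Suc p / real (Suc p)))) has_vector_derivative
        - (c * x ^ p * of_real (- ((1 - t) ^ p)))) (at t within {0..1})"
      by (intro has_vector_derivative_minus has_vector_derivative_mult_right)
    then show "((\<lambda>t. - (c * x ^ p * of_real ((1 - t) ^ Suc p / real (Suc p)))) has_vector_derivative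
        c * (x * of_real (1 - t)) ^ p) (at t within {0..1})"
      by (simp add: power_mult_distrib mult.assoc)
  qed simp
  then have "((\<lambda>t. c * (x * of_real (1 - t)) ^ p) has_integral c * x ^ p / of_nat (Suc p)) {0..1}"
    by simp
  then show ?thesis by (rule integral_unique)
qed

text \<open>Replacing the solution by \<open>0\<close> inside \<open>f\<close> costs
  \<open>L\<close> times its norm, and replacing \<open>f u 0\<close> by \<open>c * u ^ p\<close>
  costs \<open>K * norm u ^ Suc p\<close>. Both errors are one order above the main term, whose
  integral is explicit.\<close>

lemma solution_asymptotics:
  assumes fc: "\<And>u. u \<in> ball 0 \<delta> \<Longrightarrow> norm (f u 0 - c * u ^ p) \<le> K * norm u ^ Suc p" and K: "0 \<le> K"
  obtains K' where "0 \<le> K'" "\<And>x. x \<in> ball 0 \<delta> \<Longrightarrow>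
    norm (solution 1 x + c * x ^ Suc p / of_nat (Suc p)) \<le> K' * norm x ^ Suc (Suc p)"
proof -
  \<comment> \<open>In the disc of radius \<open>\<delta>\<close> one factor of
    \<open>norm u ^ Suc p\<close> may be traded for \<open>\<delta>\<close>.\<close>
  define C where "C = norm c + K * \<delta>"
  have C: "0 \<le> C" using K \<delta> by (simp add: C_def)
  have fC: "norm (f u 0) \<le> C * norm u ^ p" if u: "u \<in> ball 0 \<delta>" for u
  proof -
    have "norm (f u 0) \<le> norm (c * u ^ p) + norm (f u 0 - c * u ^ p)"
      by (metis add.commute norm_triangle_sub)
    also have "\<dots> \<le> norm c * norm u ^ p + K * norm u ^ Suc p"
      using fc[OF u] by (simp add: norm_mult norm_power)
    also have "K * norm u ^ Suc p \<le> K * (\<delta> * norm u ^ p)"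
      using u K by (intro mult_left_mono) (auto intro!: mult_right_mono)
    finally show ?thesis by (simp add: C_def algebra_simps)
  qed
  define K' where "K' = K + L * (2 * C)"
  have "norm (solution 1 x + c * x ^ Suc p / of_nat (Suc p)) \<le> K' * norm x ^ Suc (Suc p)"
    if x: "x \<in> ball 0 \<delta>" for x
  proof -
    let ?h = "\<lambda>t. f (x * of_real (1 - t)) (solution t x)"
    let ?g = "\<lambda>t. c * (x * of_real (1 - t)) ^ p"
    have ch: "continuous_on {0..1} ?h" by (rule solution_integrand_continuous[OF x])
    have cg: "continuous_on {0..1} ?g" by (intro continuous_intros)
    have "norm (integral {0..1} (\<lambda>t. ?h t - ?g t)) \<le> (K' * norm x ^ Suc p) * (1 - 0)"
    proof (rule integral_bound)
      show "continuous_on {0..1} (\<lambda>t. ?h t - ?g t)" by (intro continuous_intros ch cg)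
      fix t :: real
      assume t: "t \<in> {0..1}"
      let ?u = "x * of_real (1 - t)"
      have "norm (?h t - f ?u 0) \<le> L * norm (solution t x - 0)"
        using base_in_ball_r[OF x t] admissible_in_ball[OF solution_admissible t x] r
        by (intro lipschitz) auto
      also have "\<dots> \<le> L * (2 * C * norm x ^ Suc p)"
        using solution_norm_le[OF x fC C t] L by (intro mult_left_mono) auto
      finally have 1: "norm (?h t - f ?u 0) \<le> L * (2 * C * norm x ^ Suc p)" .
      have "norm ?u \<le> norm x"
        using t by (simp only: norm_mult norm_of_real) (intro mult_left_le, auto)
      then have "K * norm ?u ^ Suc p \<le> K * norm x ^ Suc p"
        using K by (intro mult_left_mono power_mono) auto
      with fc[OF base_in_ball[OF x t]] have 2: "norm (f ?u 0 - ?g t) \<le> K * norm x ^ Suc p" by linarith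
      show "norm (?h t - ?g t) \<le> K' * norm x ^ Suc p"
        using norm_triangle_ineq[of "?h t - f ?u 0" "f ?u 0 - ?g t"] 1 2
        by (simp add: K'_def algebra_simps)
    qed simp
    then have "norm x * norm (integral {0..1} (\<lambda>t. ?h t - ?g t)) \<le> norm x * (K' * norm x ^ Suc p)"
      by (intro mult_left_mono) auto
    moreover have "integral {0..1} (\<lambda>t. ?h t - ?g t) = integral {0..1} ?h - c * x ^ p / of_nat (Suc p)"
      using integral_diff[OF integrable_continuous_real[OF ch] integrable_continuous_real[OF cg]]
        integral_one_minus_power[of c x p] by simp
    then have "- x * integral {0..1} (\<lambda>t. ?h t - ?g t) = - x * integral {0..1} ?h + c * x ^ Suc p / of_nat (Suc p)"
      by (simp only:) (simp add: right_diff_distrib mult_ac)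
    then have "solution 1 x + c * x ^ Suc p / of_nat (Suc p) = - x * integral {0..1} (\<lambda>t. ?h t - ?g t)"
      using solution_eq[of 1 x] x by simp
    ultimately show ?thesis by (simp add: norm_mult mult_ac)
  qed
  moreover have "0 \<le> K'" using K L C by (simp add: K'_def)
  ultimately show ?thesis using that by blast
qed

end

section \<open>The involution defined by an even-order zero\<close>

text \<open>Dividing out \<open>x ^ n\<close> leaves a function with the value
  \<open>\<kappa> > 0\<close> at \<open>0\<close>; near there the principal logarithm supplies a
  holomorphic \<open>n\<close>-th root that is positive at real points. Since \<open>n\<close> is
  even, \<open>W\<close> and \<open>- W\<close> have the same \<open>n\<close>-th power
  \<open>i\<close>. The complex inverse alone does not show that real points have real images, so a
  real preimage of \<open>- W x\<close> is found separately and identified with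
  \<open>\<phi> x\<close> by injectivity.\<close>

lemma even_order_level_involution:
  fixes i :: "complex \<Rightarrow> complex"
  assumes \<delta>: "0 < \<delta>" and hol: "i holomorphic_on ball 0 \<delta>" and n: "0 < n" "even n"
    and \<kappa>: "0 < \<kappa>" and K: "0 \<le> K"
    and asym: "\<And>x. x \<in> ball 0 \<delta> \<Longrightarrow> norm (i x - of_real \<kappa> * x ^ n) \<le> K * norm x ^ Suc n"
    and re: "\<And>x. x \<in> ball 0 \<delta> \<Longrightarrow> x \<in> \<real> \<Longrightarrow> i x \<in> \<real>"
  obtains \<epsilon> \<phi> where "0 < \<epsilon>" "\<epsilon> \<le> \<delta>" "\<phi> holomorphic_on ball 0 \<epsilon>" "\<phi> 0 = 0"
    "\<And>x. x \<noteq> 0 \<Longrightarrow> \<bar>x\<bar> < \<epsilon> \<Longrightarrow> \<exists>x'. \<phi> (of_real x) = of_real x' \<and> \<bar>x'\<bar> < \<delta> \<and> x * x' < 0 \<and>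
      i (of_real x') = i (of_real x) \<and> 0 < Re (i (of_real x))"
proof -
  define v where "v x = (if x = 0 then of_real \<kappa> else i x / x ^ n)" for x
  have v_near: "norm (v x - of_real \<kappa>) \<le> K * norm x" if "x \<in> ball 0 \<delta>" for x
  proof (cases "x = 0")
    case False
    have "norm (v x - of_real \<kappa>) = norm (i x - of_real \<kappa> * x ^ n) / norm x ^ n"
      using False by (simp add: v_def diff_divide_distrib flip: norm_power norm_divide)
    also have "\<dots> \<le> K * norm x ^ Suc n / norm x ^ n"
      by (intro divide_right_mono asym that) auto
    also have "\<dots> = K * norm x" using False by simp
    finally show ?thesis .
  qed (simp add: v_def)
  have ne: "v holomorphic_on ball 0 \<delta> - {0}"
  proof (rule holomorphic_transform)
    show "(\<lambda>x. i x / x ^ n) holomorphic_on ball 0 \<delta> - {0}"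
      by (intro holomorphic_intros holomorphic_on_subset[OF hol]) auto
  qed (auto simp: v_def)
  have hv: "v holomorphic_on ball 0 \<delta>"
  proof (rule no_isolated_singularity[OF _ ne])
    show "continuous_on (ball 0 \<delta>) v"
      unfolding continuous_on_eq_continuous_at[OF open_ball]
    proof
      fix x :: complex
      assume x: "x \<in> ball 0 \<delta>"
      show "isCont v x"
      proof (cases "x = 0")
        case True
        have "((\<lambda>x. v x - of_real \<kappa>) \<longlongrightarrow> 0) (at 0)"
        proof (rule Lim_null_comparison)
          show "\<forall>\<^sub>F x in at 0. norm (v x - of_real \<kappa>) \<le> K * norm x"
            using v_near \<delta> by (auto simp: eventually_at dist_norm)
          show "((\<lambda>x::complex. K * norm x) \<longlongrightarrow> 0) (at 0)"
            by (auto intro!: tendsto_eq_intros)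
        qed
        then have "(v \<longlongrightarrow> v 0) (at 0)" using Lim_null[of v "of_real \<kappa>"] by (simp add: v_def)
        then show ?thesis using True by (simp add: isCont_def)
      next
        case False
        then show ?thesis
          using holomorphic_on_imp_continuous_on[OF ne] x
          by (auto simp: continuous_on_eq_continuous_at open_delete)
      qed
    qed
  qed auto
  \<comment> \<open>With this radius \<open>v\<close> stays within distance \<open>\<kappa>\<close>
    of \<open>\<kappa>\<close>, hence in the right half-plane, where \<open>Ln\<close> is
    holomorphic.\<close>
  define d where "d = min \<delta> (\<kappa> / (K + 1))"
  have d: "0 < d" "d \<le> \<delta>" using \<delta> \<kappa> K by (auto simp: d_def)
  have vpos: "norm (v x - of_real \<kappa>) < \<kappa>" if x: "x \<in> ball 0 d" for x
  proof -
    have "norm x < \<kappa> / (K + 1)" using x by (simp add: d_def)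
    then have "(K + 1) * norm x < \<kappa>" using K by (simp add: field_simps)
    moreover have "K * norm x \<le> (K + 1) * norm x" by (intro mult_right_mono) auto
    moreover have "norm (v x - of_real \<kappa>) \<le> K * norm x" using v_near x d by auto
    ultimately show ?thesis by linarith
  qed
  have Rev: "0 < Re (v x)" if "x \<in> ball 0 d" for x
    using vpos[OF that] abs_Re_le_cmod[of "v x - of_real \<kappa>"] by simp
  have vn: "v x \<notin> \<real>\<^sub>\<le>\<^sub>0" if "x \<in> ball 0 d" for x
    using Rev[OF that] by (auto simp: complex_nonpos_Reals_iff)
  define E where "E x = exp (Ln (v x) / of_nat n)" for x
  define W where "W x = x * E x" for x
  have hE: "E holomorphic_on ball 0 d"
    unfolding E_def using vn n d
    by (intro holomorphic_intros holomorphic_on_subset[OF hv]) auto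
  have hW: "W holomorphic_on ball 0 d"
    unfolding W_def by (intro holomorphic_intros hE)
  have i0: "i 0 = 0" using asym[of 0] \<delta> n by simp
  have Wn: "W x ^ n = i x" if x: "x \<in> ball 0 d" for x
  proof (cases "x = 0")
    case False
    have "v x \<noteq> 0" using vn[OF x] by auto
    then have "E x ^ n = v x"
      using n by (auto simp: E_def simp flip: exp_of_nat_mult)
    then show ?thesis using False by (simp add: W_def power_mult_distrib v_def)
  qed (use n i0 in \<open>simp add: W_def\<close>)
  have "(E has_field_derivative deriv E 0) (at 0)"
    using d by (intro holomorphic_derivI[OF hE]) auto
  then have "(W has_field_derivative E 0) (at 0)"
    unfolding W_def by (auto intro!: derivative_eq_intros)
  then have dW: "deriv W 0 \<noteq> 0" by (simp add: DERIV_imp_deriv E_def)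
  have c0: "0 \<in> ball (0 :: complex) d" using d by simp
  obtain \<rho> where \<rho>: "0 < \<rho>" "ball 0 \<rho> \<subseteq> ball (0 :: complex) d"
    and op: "open (W ` ball 0 \<rho>)" and inj: "inj_on W (ball 0 \<rho>)"
    by (rule has_complex_derivative_locally_invertible[OF hW c0 open_ball dW])
  have hW\<rho>: "W holomorphic_on ball 0 \<rho>" using hW \<rho>(2) holomorphic_on_subset by blast
  obtain g where hg: "g holomorphic_on W ` ball 0 \<rho>" and g: "\<And>z. z \<in> ball 0 \<rho> \<Longrightarrow> g (W z) = z"
    by (rule holomorphic_has_inverse[OF hW\<rho> open_ball inj]) (rule that, assumption, simp)
  \<comment> \<open>The real trace of \<open>W\<close>, with a real exponential in place of the
    complex root; in this form it has the sign of \<open>x\<close> for every real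
    \<open>x\<close>.\<close>
  define w where "w x = x * exp (ln (Re (v (of_real x))) / real n)" for x :: real
  have Ww: "W (of_real x) = of_real (w x)" if x: "of_real x \<in> ball (0 :: complex) d" for x
  proof -
    have "v (of_real x) \<in> \<real>"
      using re[of "of_real x"] x d by (auto simp: v_def intro!: Reals_divide)
    then obtain a where a: "v (of_real x) = of_real a" by (auto elim: Reals_cases)
    have "0 < a" using Rev[OF x] a by simp
    then show ?thesis
      using a by (simp add: W_def E_def w_def Ln_of_real flip: exp_of_real)
  qed
  have w_sgn: "0 < w x \<longleftrightarrow> 0 < x" "w x < 0 \<longleftrightarrow> x < 0" for x
    by (simp_all add: w_def zero_less_mult_iff mult_less_0_iff)
  define t where "t = \<rho> / 2"
  have t: "0 < t" "t < \<rho>" using \<rho> by (auto simp: t_def)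
  have \<rho>d: "of_real x \<in> ball (0 :: complex) d" if "\<bar>x\<bar> < \<rho>" for x :: real
    using subsetD[OF \<rho>(2), of "of_real x"] that by simp
  \<comment> \<open>If \<open>\<bar>w x\<bar> < c\<close>, then \<open>- w x\<close> lies between
    \<open>w (- t)\<close> and \<open>w t\<close>, as the intermediate value theorem
    requires.\<close>
  define c where "c = min (w t) (- w (- t))"
  have c: "0 < c" using t w_sgn[of t] w_sgn[of "- t"] by (simp add: c_def)
  have W0: "0 \<in> W ` ball 0 \<rho>" using \<rho>(1) by (intro image_eqI[of _ _ 0]) (simp_all add: W_def)
  obtain e0 where e0: "0 < e0" "ball 0 e0 \<subseteq> W ` ball 0 \<rho>"
    by (rule openE[OF op W0])
  have "isCont W 0"
    using holomorphic_on_imp_continuous_on[OF hW] c0 by (simp add: continuous_on_eq_continuous_at)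
  moreover have m0: "0 < min e0 c" using e0 c by simp
  moreover have "W 0 = 0" by (simp add: W_def)
  ultimately have "\<exists>d1>0. \<forall>x. norm x < d1 \<longrightarrow> norm (W x) < min e0 c"
    unfolding continuous_at_eps_delta by (auto dest!: spec[of _ "min e0 c"])
  then obtain d1 where d1: "0 < d1" "\<And>x. norm x < d1 \<Longrightarrow> norm (W x) < min e0 c" by blast
  define \<epsilon> where "\<epsilon> = min \<rho> d1"
  have \<epsilon>: "0 < \<epsilon>" "\<epsilon> \<le> \<rho>" "\<epsilon> \<le> d1" using \<rho> d1 by (auto simp: \<epsilon>_def)
  have \<rho>_le: "\<rho> \<le> d" using \<rho> by (simp add: ball_subset_ball_iff)
  define \<phi> where "\<phi> x = g (- W x)" for x
  have Wim: "- W x \<in> W ` ball 0 \<rho>" if "x \<in> ball 0 \<epsilon>" for x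
    using d1(2)[of x] that \<epsilon>(3) by (intro subsetD[OF e0(2)]) simp
  have "(g \<circ> (\<lambda>x. - W x)) holomorphic_on ball 0 \<epsilon>"
    by (rule holomorphic_on_compose_gen[OF _ hg])
      (use Wim \<epsilon> \<rho>_le in \<open>auto intro!: holomorphic_intros holomorphic_on_subset[OF hW]\<close>)
  then have h\<phi>: "\<phi> holomorphic_on ball 0 \<epsilon>" by (simp add: \<phi>_def[abs_def] o_def)
  have \<phi>0: "\<phi> 0 = 0" using g[of 0] \<rho>(1) by (simp add: \<phi>_def W_def)
  have main: "\<exists>x'. \<phi> (of_real x) = of_real x' \<and> \<bar>x'\<bar> < \<delta> \<and> x * x' < 0 \<and>
      i (of_real x') = i (of_real x) \<and> 0 < Re (i (of_real x))" if x: "x \<noteq> 0" "\<bar>x\<bar> < \<epsilon>" for x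
  proof -
    have xd: "of_real x \<in> ball (0 :: complex) d" using x \<epsilon>(2) \<rho>d[of x] by simp
    have "\<bar>w x\<bar> < c"
      using d1(2)[of "of_real x"] x \<epsilon>(3) Ww[OF xd] by simp
    then have wx: "w (- t) \<le> - w x" "- w x \<le> w t" by (auto simp: c_def)
    have "continuous_on {- t..t} (\<lambda>x. Re (W (of_real x)))"
      using t \<rho>d
      by (intro continuous_intros continuous_on_compose2[OF holomorphic_on_imp_continuous_on[OF hW]]) auto
    then have "continuous_on {- t..t} w"
      by (rule continuous_on_eq) (use Ww \<rho>d t in auto)
    from IVT'[OF wx _ this] t obtain x' where x': "- t \<le> x'" "x' \<le> t" "w x' = - w x" by auto
    have x'\<rho>: "\<bar>x'\<bar> < \<rho>" using x' t by auto
    have WW: "W (of_real x') = - W (of_real x)"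
      using Ww[OF xd] Ww[OF \<rho>d[OF x'\<rho>]] x'(3) by simp
    have "\<phi> (of_real x) = of_real x'"
      using g[of "of_real x'"] WW x'\<rho> by (simp add: \<phi>_def)
    moreover have "\<bar>x'\<bar> < \<delta>" using x'\<rho> \<rho>_le d(2) by linarith
    moreover have "x * x' < 0"
      using x'(3) w_sgn[of x] w_sgn[of x'] x(1)
      by (cases x "0 :: real" rule: linorder_cases) (simp_all add: mult_less_0_iff)
    moreover have ii: "i (of_real x') = i (of_real x)"
      using Wn[OF xd] Wn[OF \<rho>d[OF x'\<rho>]] WW n(2) by simp
    moreover have "0 < Re (i (of_real x))"
    proof -
      have "w x \<noteq> 0" using w_sgn[of x] x(1) by auto
      then have "0 < w x ^ n" using n(2) by (simp add: zero_less_power_eq)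
      moreover have "i (of_real x) = of_real (w x ^ n)" using Wn[OF xd] Ww[OF xd] by simp
      ultimately show ?thesis by simp
    qed
    ultimately show ?thesis by blast
  qed
  have "\<epsilon> \<le> \<delta>" using \<epsilon>(2) \<rho>_le d(2) by simp
  from that[OF \<epsilon>(1) this h\<phi> \<phi>0 main] show ?thesis .
qed

text \<open>After the initial rise, a first return to zero would have to be reached from above,
  whereas a positive derivative there makes \<open>y\<close> negative just before. The end
  \<open>1\<close> needs its own hypothesis: in the application it is the origin, where the slope of
  the solution through zero degenerates.\<close>

lemma positive_if_increasing_at_zeros:
  fixes y :: "real \<Rightarrow> real"
  assumes der: "\<And>s. s \<in> {0..1} \<Longrightarrow> (y has_real_derivative y' s) (at s within {0..1})"
    and y0: "y 0 = 0" and y1: "0 < y 1"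
    and zeros: "\<And>s. s \<in> {0..<1} \<Longrightarrow> y s = 0 \<Longrightarrow> 0 < y' s"
    and s: "s \<in> {0<..1}"
  shows "0 < y s"
proof (rule ccontr)
  assume neg: "\<not> 0 < y s"
  have cont: "continuous_on {0..1} y"
    using der DERIV_continuous continuous_on_eq_continuous_within by blast
  obtain d where d: "0 < d" "\<And>h. 0 < h \<Longrightarrow> 0 + h \<in> {0..1} \<Longrightarrow> h < d \<Longrightarrow> y 0 < y (0 + h)"
    using has_real_derivative_pos_inc_right[OF der[of 0] zeros[of 0]] y0 by auto
  \<comment> \<open>Keeping \<open>e\<close> at most \<open>s\<close> places the supposed bad time
    \<open>s\<close> in the set \<open>C\<close> below.\<close>
  define e where "e = min (d / 2) s"
  have e: "0 < e" "e < d" "e \<le> s" "e \<in> {0..1}" using d s by (auto simp: e_def)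
  have ye: "0 < y e" using d(2)[of e] e y0 by simp
  define C where "C = {e..1} \<inter> y -` {..0}"
  have ce: "continuous_on {e..1} y" using cont by (rule continuous_on_subset) (use e in auto)
  have "closed C" unfolding C_def by (rule continuous_closed_preimage[OF ce]) auto
  then have "compact C" by (simp add: C_def bounded_Int compact_eq_bounded_closed)
  moreover have "s \<in> C" using neg s e by (simp add: C_def)
  ultimately obtain s1 where s1: "s1 \<in> C" "\<And>t. t \<in> C \<Longrightarrow> s1 \<le> t"
    using compact_attains_inf[of C] by auto
  have s1': "e \<le> s1" "s1 \<le> 1" "y s1 \<le> 0" using s1(1) by (auto simp: C_def)
  then have es1: "e < s1" using ye by (cases "e = s1") auto
  have "continuous_on {e..s1} y" using ce by (rule continuous_on_subset) (use s1' in auto)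
  then obtain z where z: "e \<le> z" "z \<le> s1" "y z = 0"
    using IVT2'[of y s1 0 e] s1' ye by auto
  then have "z \<in> C" using s1' by (simp add: C_def)
  then have ys1: "y s1 = 0" using s1(2) z by force
  then have "s1 < 1" using y1 s1'(2) by (cases "s1 = 1") auto
  then obtain d' where d': "0 < d'" "\<And>h. 0 < h \<Longrightarrow> s1 - h \<in> {0..1} \<Longrightarrow> h < d' \<Longrightarrow> y (s1 - h) < y s1"
    using has_real_derivative_pos_inc_left[OF der[of s1] zeros[of s1]] ys1 e(1) es1 by auto
  define h where "h = min (d' / 2) (s1 - e)"
  have h: "0 < h" "h < d'" "e \<le> s1 - h" using d' es1 by (auto simp: h_def)
  then have "y (s1 - h) < 0" using d'(2)[of h] ys1 e s1' by auto
  then have "s1 - h \<in> C" using h s1' by (auto simp: C_def)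
  from s1(2)[OF this] h(1) show False by simp
qed

section \<open>Real solutions and the choice of constants\<close>

context graph_equation
begin

lemma real_solution:
  fixes x :: real
  assumes x: "\<bar>x\<bar> < \<delta>" and s: "s \<in> {0..1}"
  defines "y \<equiv> \<lambda>s. Re (solution s (of_real x))"
  shows "solution s (of_real x) = of_real (y s)" and "\<bar>y s\<bar> < r"
    and "(y has_real_derivative - x * Re (f (of_real (x * (1 - s))) (of_real (y s)))) (at s within {0..1})"
proof -
  have xb: "of_real x \<in> ball (0 :: complex) \<delta>" using x by simp
  have "of_real x \<in> ball 0 \<delta> \<inter> (\<real> :: complex set)" using xb by simp
  then have "solution s (of_real x) \<in> \<real>"
    using solution_admissible s unfolding admissible_def by blast
  then show 1: "solution s (of_real x) = of_real (y s)" by (simp add: y_def)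
  show "\<bar>y s\<bar> < r"
    using admissible_in_ball[OF solution_admissible s xb] 1 by simp
  show "(y has_real_derivative - x * Re (f (of_real (x * (1 - s))) (of_real (y s)))) (at s within {0..1})"
    using bounded_linear.has_vector_derivative[OF bounded_linear_Re solution_has_vector_derivative[OF s xb]] 1
    unfolding y_def has_real_derivative_iff_has_vector_derivative by simp
qed

end

lemma graph_equation_exists:
  assumes f: "holo2 R f" and r: "0 < r" "r < R" and B: "0 < B"
    and real_f: "\<And>u v. u \<in> \<real> \<Longrightarrow> v \<in> \<real> \<Longrightarrow> u \<in> ball 0 r \<Longrightarrow> v \<in> ball 0 r \<Longrightarrow> f u v \<in> \<real>"
  obtains M L \<delta> where "graph_equation f R r M L \<delta>" "\<delta> \<le> B"
proof -
  have sub: "cball 0 r \<subseteq> ball (0 :: complex) R" using r by auto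
  have "continuous_on (cball 0 r \<times> cball 0 r) (\<lambda>p. f (fst p) (snd p))"
    using f sub by (auto simp: holo2_def split_beta elim!: continuous_on_subset)
  then have "compact ((\<lambda>p. f (fst p) (snd p)) ` (cball 0 r \<times> cball 0 r))"
    by (intro compact_continuous_image compact_Times) auto
  then obtain M where M: "0 < M" "\<forall>p \<in> cball 0 r \<times> cball 0 r. norm (f (fst p) (snd p)) \<le> M"
    using bounded_pos[of "(\<lambda>p. f (fst p) (snd p)) ` (cball 0 r \<times> cball 0 r)"]
    by (auto dest!: compact_imp_bounded)
  obtain L where L: "0 < L" "\<And>u v w. u \<in> cball 0 r \<Longrightarrow> v \<in> cball 0 r \<Longrightarrow> w \<in> cball 0 r \<Longrightarrow>
       norm (f u v - f u w) \<le> L * norm (v - w)"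
    using holo2_Lipschitz_snd[OF f r] by blast
  \<comment> \<open>The bound \<open>r / (2 * M)\<close> keeps the iterates inside the bidisc,
    \<open>1 / (2 * L)\<close> gives the contraction factor \<open>1 / 2\<close>, and
    \<open>B\<close> leaves the caller free to shrink the disc further.\<close>
  define \<delta> where "\<delta> = min (min r B) (min (r / (2 * M)) (1 / (2 * L)))"
  have \<delta>: "0 < \<delta>" "\<delta> \<le> r" "\<delta> \<le> B" "\<delta> \<le> r / (2 * M)" "\<delta> \<le> 1 / (2 * L)"
    using r M L B by (auto simp: \<delta>_def)
  have "\<delta> * M \<le> r / (2 * M) * M" using \<delta>(4) M by (intro mult_right_mono) auto
  then have 1: "\<delta> * M < r" using M r by simp
  have "\<delta> * L \<le> 1 / (2 * L) * L" using \<delta>(5) L by (intro mult_right_mono) auto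
  then have 2: "\<delta> * L \<le> 1 / 2" using L by simp
  have "graph_equation f R r M L \<delta>"
  proof
    show "norm (f u v) \<le> M" if "u \<in> cball 0 r" "v \<in> cball 0 r" for u v
      using M(2) that by fastforce
  qed (fact f r \<delta> 1 2 real_f L(2) less_imp_le[OF L(1)])+
  then show ?thesis using \<delta>(3) by (rule that)
qed

section \<open>Arcs of graphs joining a point to its return point\<close>

text \<open>The values \<open>1\<close> and \<open>-1\<close> of \<open>\<sigma>\<close> select the
  upper and the lower half-plane. Segments instead of intervals cover both orders of
  \<open>x\<close> and \<open>x'\<close>.\<close>

definition graph_arc ::
    "(real \<Rightarrow> real \<Rightarrow> real) \<Rightarrow> real \<Rightarrow> real \<Rightarrow> real \<Rightarrow> real \<Rightarrow> (real \<Rightarrow> real) \<Rightarrow> bool" where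
  "graph_arc g \<sigma> B x x' \<eta> \<longleftrightarrow> \<eta> x = 0 \<and> \<eta> x' = 0 \<and>
     (\<forall>\<xi> \<in> closed_segment x x'. \<bar>\<xi>\<bar> < B \<and> \<bar>\<eta> \<xi>\<bar> < B \<and>
        (\<eta> has_real_derivative g \<xi> (\<eta> \<xi>)) (at \<xi> within closed_segment x x')) \<and>
     (\<forall>\<xi> \<in> open_segment x x'. 0 < \<sigma> * \<eta> \<xi>)"

text \<open>By \<open>sgn\<close>, whenever the solution meets the axis strictly between
  \<open>z\<close> and \<open>0\<close>, or starts from it at \<open>z\<close>,
  \<open>\<sigma>\<close> times the solution is increasing in the direction of \<open>0\<close>.
  With a positive value at \<open>0\<close> it is positive all the way.\<close>

lemma (in graph_equation) half_arc:
  fixes z \<sigma> :: real and g :: "real \<Rightarrow> real \<Rightarrow> real"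
  assumes z: "z \<noteq> 0" "\<bar>z\<bar> < \<delta>"
    and g: "\<And>u v. \<bar>u\<bar> < r \<Longrightarrow> \<bar>v\<bar> < r \<Longrightarrow> f (of_real u) (of_real v) = of_real (g u v)"
    and sgn: "\<And>u. u \<noteq> 0 \<Longrightarrow> \<bar>u\<bar> < \<delta> \<Longrightarrow> \<sigma> * u * g u 0 < 0"
    and pos: "0 < \<sigma> * Re (solution 1 (of_real z))"
  obtains \<eta> where "\<eta> z = 0" "\<eta> 0 = Re (solution 1 (of_real z))"
    "\<And>\<xi>. \<xi> \<in> closed_segment z 0 \<Longrightarrow> \<bar>\<eta> \<xi>\<bar> < r \<and>
      (\<eta> has_real_derivative g \<xi> (\<eta> \<xi>)) (at \<xi> within closed_segment z 0)"
    "\<And>\<xi>. \<xi> \<in> closed_segment z 0 \<Longrightarrow> \<xi> \<noteq> z \<Longrightarrow> 0 < \<sigma> * \<eta> \<xi>"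
proof -
  define y where "y s = Re (solution s (of_real z))" for s
  note rs = real_solution[OF z(2), folded y_def]
  have le: "\<bar>z * (1 - s)\<bar> \<le> \<bar>z\<bar>" if "s \<in> {0..1}" for s :: real
    unfolding abs_mult using that by (intro mult_left_le) auto
  have y': "(y has_real_derivative - z * g (z * (1 - s)) (y s)) (at s within {0..1})"
    if s: "s \<in> {0..1}" for s
  proof -
    have "\<bar>z * (1 - s)\<bar> < r" using le[OF s] z(2) \<delta>(2) by linarith
    with rs(3)[OF s] g[OF this rs(2)[OF s]] show ?thesis by (simp only: Re_complex_of_real)
  qed
  have y0: "y 0 = 0" using solution_0[of "of_real z"] z by (simp add: y_def)
  have ypos: "0 < \<sigma> * y s" if "s \<in> {0<..1}" for s
  proof (rule positive_if_increasing_at_zeros[OF _ _ _ _ that])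
    show "((\<lambda>s. \<sigma> * y s) has_real_derivative \<sigma> * (- z * g (z * (1 - s)) (y s))) (at s within {0..1})"
      if "s \<in> {0..1}" for s
      by (rule DERIV_cmult[OF y'[OF that]])
    show "\<sigma> * y 0 = 0" using y0 by simp
    show "0 < \<sigma> * y 1" using pos by (simp add: y_def)
    fix s :: real
    assume s: "s \<in> {0..<1}" and zero: "\<sigma> * y s = 0"
    have "\<sigma> \<noteq> 0" using pos by auto
    then have ys: "y s = 0" using zero by simp
    have "\<bar>z * (1 - s)\<bar> < \<delta>" using le[of s] s z(2) by force
    then have "\<sigma> * (z * (1 - s)) * g (z * (1 - s)) 0 < 0"
      using s z(1) by (intro sgn) auto
    then have "(1 - s) * (\<sigma> * z * g (z * (1 - s)) 0) < 0" by (simp only: mult_ac)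
    then have "\<sigma> * z * g (z * (1 - s)) 0 < 0" using s by (simp add: mult_less_0_iff)
    then show "0 < \<sigma> * (- z * g (z * (1 - s)) (y s))" using ys by simp
  qed
  \<comment> \<open>This undoes the substitution \<open>\<xi> = z * (1 - s)\<close>, passing from
    the parameter \<open>s\<close> back to the abscissa.\<close>
  define \<eta> where "\<eta> \<xi> = y (1 - \<xi> / z)" for \<xi>
  have seg: "1 - \<xi> / z \<in> {0..1}" if "\<xi> \<in> closed_segment z 0" for \<xi>
    using that z(1) by (cases "0 < z") (auto simp: closed_segment_eq_real_ivl field_simps split: if_splits)
  have "\<eta> z = 0" using z y0 by (simp add: \<eta>_def)
  moreover have "\<eta> 0 = Re (solution 1 (of_real z))" by (simp add: \<eta>_def y_def)
  moreover have "\<bar>\<eta> \<xi>\<bar> < r \<and> (\<eta> has_real_derivative g \<xi> (\<eta> \<xi>)) (at \<xi> within closed_segment z 0)"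
    if \<xi>: "\<xi> \<in> closed_segment z 0" for \<xi>
  proof
    show "\<bar>\<eta> \<xi>\<bar> < r" unfolding \<eta>_def by (rule rs(2)[OF seg[OF \<xi>]])
    have "z * (1 - (1 - \<xi> / z)) = \<xi>" using z by (simp add: field_simps)
    then have "(y has_real_derivative - z * g \<xi> (\<eta> \<xi>)) (at (1 - \<xi> / z) within {0..1})"
      using y'[OF seg[OF \<xi>]] by (simp add: \<eta>_def)
    then have "(y has_real_derivative - z * g \<xi> (\<eta> \<xi>))
        (at (1 - \<xi> / z) within (\<lambda>\<xi>. 1 - \<xi> / z) ` closed_segment z 0)"
      by (rule has_field_derivative_subset) (use seg in blast)
    moreover have "((\<lambda>\<xi>. 1 - \<xi> / z) has_real_derivative - (1 / z)) (at \<xi> within closed_segment z 0)"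
      using z by (auto intro!: derivative_eq_intros simp: field_simps)
    ultimately have "((y \<circ> (\<lambda>\<xi>. 1 - \<xi> / z)) has_real_derivative (- z * g \<xi> (\<eta> \<xi>)) * (- (1 / z)))
        (at \<xi> within closed_segment z 0)"
      by (rule DERIV_image_chain)
    moreover have "y \<circ> (\<lambda>\<xi>. 1 - \<xi> / z) = \<eta>" by (simp add: \<eta>_def fun_eq_iff)
    ultimately show "(\<eta> has_real_derivative g \<xi> (\<eta> \<xi>)) (at \<xi> within closed_segment z 0)"
      using z by simp
  qed
  moreover have "0 < \<sigma> * \<eta> \<xi>" if \<xi>: "\<xi> \<in> closed_segment z 0" "\<xi> \<noteq> z" for \<xi>
  proof -
    have "1 - \<xi> / z \<noteq> 0" using \<xi>(2) z by (simp add: field_simps)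
    with seg[OF \<xi>(1)] have "1 - \<xi> / z \<in> {0<..1}"
      unfolding greaterThanAtMost_iff atLeastAtMost_iff by linarith
    then show ?thesis unfolding \<eta>_def by (rule ypos)
  qed
  ultimately show ?thesis by (rule that)
qed

text \<open>At the junction \<open>0\<close> the values agree by \<open>eq\<close>; the slopes then
  agree as well, because both halves solve the same equation.\<close>

lemma graph_arc_glue:
  assumes xx: "x * x' < 0" and B: "\<bar>x\<bar> < B" "\<bar>x'\<bar> < B" "r \<le> B" and eq: "\<eta> 0 = \<theta> 0"
    and \<eta>: "\<eta> x = 0" "\<And>\<xi>. \<xi> \<in> closed_segment x 0 \<Longrightarrow> \<bar>\<eta> \<xi>\<bar> < r \<and>
      (\<eta> has_real_derivative g \<xi> (\<eta> \<xi>)) (at \<xi> within closed_segment x 0)"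
    "\<And>\<xi>. \<xi> \<in> closed_segment x 0 \<Longrightarrow> \<xi> \<noteq> x \<Longrightarrow> 0 < \<sigma> * \<eta> \<xi>"
    and \<theta>: "\<theta> x' = 0" "\<And>\<xi>. \<xi> \<in> closed_segment x' 0 \<Longrightarrow> \<bar>\<theta> \<xi>\<bar> < r \<and>
      (\<theta> has_real_derivative g \<xi> (\<theta> \<xi>)) (at \<xi> within closed_segment x' 0)"
    "\<And>\<xi>. \<xi> \<in> closed_segment x' 0 \<Longrightarrow> \<xi> \<noteq> x' \<Longrightarrow> 0 < \<sigma> * \<theta> \<xi>"
  shows "graph_arc g \<sigma> B x x' (\<lambda>\<xi>. if \<xi> \<in> closed_segment x 0 then \<eta> \<xi> else \<theta> \<xi>)"
proof -
  let ?S = "closed_segment x 0" and ?T = "closed_segment x' 0"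
  let ?h = "\<lambda>\<xi>. if \<xi> \<in> ?S then \<eta> \<xi> else \<theta> \<xi>"
  have un: "closed_segment x x' = ?S \<union> ?T" and int: "?S \<inter> ?T = {0}"
    and x'S: "x' \<notin> ?S" and xn: "x \<noteq> 0"
    using xx by (auto simp: closed_segment_eq_real_ivl mult_less_0_iff split: if_splits)
  have cl: "closure ?S \<inter> closure ?T = {0}" using int by simp
  have abs_le: "\<bar>\<xi>\<bar> < B" if "\<xi> \<in> closed_segment x x'" for \<xi>
    using that B by (auto simp: closed_segment_eq_real_ivl split: if_splits)
  have der: "(?h has_real_derivative g \<xi> (?h \<xi>)) (at \<xi> within closed_segment x x')"
    if "\<xi> \<in> closed_segment x x'" for \<xi>
  proof -
    have "(?h has_vector_derivative (if \<xi> \<in> ?S then g \<xi> (\<eta> \<xi>) else g \<xi> (\<theta> \<xi>))) (at \<xi> within closed_segment x x')"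
    proof (rule has_vector_derivative_If_within_closures[OF _ un])
      have ST: "?S \<union> {0} = ?S" "?T \<union> {0} = ?T" by auto
      show "(\<eta> has_vector_derivative g \<xi> (\<eta> \<xi>)) (at \<xi> within ?S \<union> (closure ?S \<inter> closure ?T))"
        if "\<xi> \<in> ?S \<union> (closure ?S \<inter> closure ?T)"
        using \<eta>(2)[of \<xi>] that unfolding cl ST has_real_derivative_iff_has_vector_derivative by blast
      show "(\<theta> has_vector_derivative g \<xi> (\<theta> \<xi>)) (at \<xi> within ?T \<union> (closure ?S \<inter> closure ?T))"
        if "\<xi> \<in> ?T \<union> (closure ?S \<inter> closure ?T)"
        using \<theta>(2)[of \<xi>] that unfolding cl ST has_real_derivative_iff_has_vector_derivative by blast
      show "\<xi> \<in> ?S \<union> ?T" using that un by simp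
      assume "\<xi> \<in> closure ?S" "\<xi> \<in> closure ?T"
      then have "\<xi> = 0" using cl by blast
      then show "\<eta> \<xi> = \<theta> \<xi>" "g \<xi> (\<eta> \<xi>) = g \<xi> (\<theta> \<xi>)" using eq by simp_all
    qed
    also have "(if \<xi> \<in> ?S then g \<xi> (\<eta> \<xi>) else g \<xi> (\<theta> \<xi>)) = g \<xi> (?h \<xi>)" by simp
    finally show ?thesis by (simp only: has_real_derivative_iff_has_vector_derivative)
  qed
  show ?thesis
    unfolding graph_arc_def
  proof (intro conjI ballI)
    show "?h x = 0" using \<eta>(1) by simp
    show "?h x' = 0" using x'S \<theta>(1) by simp
    fix \<xi>
    assume \<xi>: "\<xi> \<in> closed_segment x x'"
    show "\<bar>\<xi>\<bar> < B" by (rule abs_le[OF \<xi>])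
    show "\<bar>?h \<xi>\<bar> < B" using \<eta>(2)[of \<xi>] \<theta>(2)[of \<xi>] \<xi> un B(3) by fastforce
    show "(?h has_real_derivative g \<xi> (?h \<xi>)) (at \<xi> within closed_segment x x')"
      by (rule der[OF \<xi>])
  next
    fix \<xi>
    assume "\<xi> \<in> open_segment x x'"
    then have "\<xi> \<in> ?S \<union> ?T" "\<xi> \<noteq> x" "\<xi> \<noteq> x'" using un by (auto simp: open_segment_def)
    then show "0 < \<sigma> * ?h \<xi>" using \<eta>(3)[of \<xi>] \<theta>(3)[of \<xi>] by auto
  qed
qed

text \<open>The condition \<open>\<sigma> * c < 0\<close> acts twice: it makes the leading
  coefficient of \<open>\<sigma>\<close> times the end value positive, so that solutions from both
  sides reach abscissa \<open>0\<close> in the half-plane, and it fixes the direction in which a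
  solution may cross the axis.\<close>

lemma analytic_return_graph:
  fixes g :: "real \<Rightarrow> real \<Rightarrow> real"
  assumes f: "holo2 R f" and R: "0 < R" and B: "0 < B"
    and g: "\<And>u v. \<bar>u\<bar> < R \<Longrightarrow> \<bar>v\<bar> < R \<Longrightarrow> f (of_real u) (of_real v) = of_real (g u v)"
    and \<rho>: "0 < \<rho>" and b: "b holomorphic_on ball 0 \<rho>"
    and fb: "\<And>u. u \<in> ball 0 \<rho> \<Longrightarrow> f u 0 = u ^ p * b u"
    and p: "odd p" and b0: "b 0 = of_real c" and \<sigma>: "\<bar>\<sigma>\<bar> = 1" and c: "\<sigma> * c < 0"
  obtains \<epsilon> \<phi> where "0 < \<epsilon>" "\<phi> holomorphic_on ball 0 \<epsilon>" "\<phi> 0 = 0"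
    "\<And>x. x \<noteq> 0 \<Longrightarrow> \<bar>x\<bar> < \<epsilon> \<Longrightarrow> g x 0 \<noteq> 0 \<and>
      (\<exists>x' \<eta>. \<phi> (of_real x) = of_real x' \<and> x \<noteq> x' \<and> graph_arc g \<sigma> B x x' \<eta>)"
proof -
  define r where "r = min R (min B \<rho>) / 2"
  have r: "0 < r" "r < R" "r < B" "r < \<rho>" using R B \<rho> by (auto simp: r_def)
  have rB: "r \<le> B" using r by simp
  have sub: "cball 0 r \<subseteq> ball (0 :: complex) \<rho>" using r by auto
  have hd: "deriv b holomorphic_on ball 0 \<rho>" by (rule holomorphic_deriv[OF b open_ball])
  have "compact (deriv b ` cball 0 r)"
    using continuous_on_subset[OF holomorphic_on_imp_continuous_on[OF hd] sub]
    by (intro compact_continuous_image) auto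
  then obtain K where K: "0 < K" "\<And>u. u \<in> cball 0 r \<Longrightarrow> norm (deriv b u) \<le> K"
    using bounded_pos[of "deriv b ` cball 0 r"] by (auto dest!: compact_imp_bounded)
  have bK: "norm (b u - of_real c) \<le> K * norm u" if "u \<in> cball 0 r" for u
  proof -
    have "norm (b u - b 0) \<le> K * norm (u - 0)"
    proof (rule field_differentiable_bound[OF convex_cball _ K(2)])
      show "(b has_field_derivative deriv b z) (at z within cball 0 r)" if "z \<in> cball 0 r" for z
        using holomorphic_derivI[OF b open_ball] that sub by blast
    qed (use that r in auto)
    then show ?thesis by (simp add: b0)
  qed
  have c0: "c \<noteq> 0" using c by auto
  \<comment> \<open>For \<open>\<bar>x\<bar> < \<delta> \<le> \<bar>c\<bar> / K\<close> the
    coefficient \<open>b x\<close> is closer to \<open>c\<close> than \<open>0\<close> is, so its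
    real part keeps the sign of \<open>c\<close>.\<close>
  define B' where "B' = min B (\<bar>c\<bar> / K)"
  have B': "0 < B'" "B' \<le> B" "B' \<le> \<bar>c\<bar> / K" using B K c0 by (auto simp: B'_def)
  have real_f: "f u v \<in> \<real>" if uv: "u \<in> \<real>" "v \<in> \<real>" "u \<in> ball 0 r" "v \<in> ball 0 r" for u v
  proof -
    obtain s where s: "u = of_real s" by (rule Reals_cases[OF uv(1)])
    obtain t where t: "v = of_real t" by (rule Reals_cases[OF uv(2)])
    have "f u v = of_real (g s t)" using s t uv(3,4) r(2) g[of s t] by simp
    then show ?thesis by simp
  qed
  obtain M L \<delta> where ge: "graph_equation f R r M L \<delta>" and \<delta>B: "\<delta> \<le> B'"
    using graph_equation_exists[OF f r(1,2) B'(1) real_f] by blast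
  interpret graph_equation f R r M L \<delta> by (rule ge)
  have K\<delta>: "\<delta> * K \<le> \<bar>c\<bar>"
    using \<delta>B B'(3) K(1) by (metis order_trans pos_le_divide_eq)
  have fc: "norm (f u 0 - of_real c * u ^ p) \<le> K * norm u ^ Suc p" if u: "u \<in> ball 0 \<delta>" for u
  proof -
    have u': "u \<in> cball 0 r" using u \<delta>(2) by auto
    have "f u 0 - of_real c * u ^ p = u ^ p * (b u - of_real c)"
      using fb[of u] subsetD[OF sub u'] by (simp add: algebra_simps)
    then have "norm (f u 0 - of_real c * u ^ p) = norm u ^ p * norm (b u - of_real c)"
      by (simp add: norm_mult norm_power)
    also have "\<dots> \<le> norm u ^ p * (K * norm u)" by (intro mult_left_mono bK u') auto
    finally show ?thesis by (simp add: mult_ac)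
  qed
  have sgn: "\<sigma> * x * g x 0 < 0" if x: "x \<noteq> 0" "\<bar>x\<bar> < \<delta>" for x
  proof -
    let ?b = "Re (b (of_real x))"
    have xr: "of_real x \<in> cball (0 :: complex) r" using x \<delta>(2) by simp
    have "of_real (g x 0) = (of_real x) ^ p * b (of_real x)"
      using fb[of "of_real x"] subsetD[OF sub xr] g[of x 0] x \<delta>(2) r R by simp
    moreover have "Re (of_real a * w) = a * Re w" for a w by simp
    ultimately have gx: "g x 0 = x ^ p * ?b" by (metis Re_complex_of_real of_real_power)
    have "\<bar>?b - c\<bar> \<le> K * \<bar>x\<bar>"
      using bK[OF xr] abs_Re_le_cmod[of "b (of_real x) - of_real c"] by simp
    also have "\<dots> < K * \<delta>" using x K by simp
    finally have "\<bar>?b - c\<bar> < \<bar>c\<bar>" using K\<delta> by (simp add: mult.commute)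
    then have "\<bar>\<sigma> * (?b - c)\<bar> < \<bar>\<sigma> * c\<bar>" using \<sigma> by (simp add: abs_mult)
    then have \<sigma>b: "\<sigma> * ?b < 0" using c by (simp add: right_diff_distrib)
    have "0 < x ^ Suc p" using p x(1) by (subst zero_less_power_eq) simp
    then have "x ^ Suc p * (\<sigma> * ?b) < 0" using \<sigma>b by (simp only: mult_pos_neg)
    then show ?thesis by (simp add: gx mult_ac)
  qed
  obtain K' where K': "0 \<le> K'" "\<And>x. x \<in> ball 0 \<delta> \<Longrightarrow>
      norm (solution 1 x + of_real c * x ^ Suc p / of_nat (Suc p)) \<le> K' * norm x ^ Suc (Suc p)"
    using solution_asymptotics[OF fc] K(1) by auto
  \<comment> \<open>The end value behaves like \<open>- c * x ^ Suc p / Suc p\<close>; the factor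
    \<open>\<sigma>\<close> makes the leading coefficient positive for either half-plane.\<close>
  define i where "i x = of_real \<sigma> * solution 1 x" for x
  define \<kappa> where "\<kappa> = - (\<sigma> * c) / real (Suc p)"
  have \<kappa>: "0 < \<kappa>" unfolding \<kappa>_def using c by (intro divide_pos_pos) auto
  have hi: "i holomorphic_on ball 0 \<delta>"
    using solution_admissible unfolding i_def admissible_def by (intro holomorphic_intros) auto
  have asym: "norm (i x - of_real \<kappa> * x ^ Suc p) \<le> K' * norm x ^ Suc (Suc p)" if "x \<in> ball 0 \<delta>" for x
  proof -
    have "i x - of_real \<kappa> * x ^ Suc p = of_real \<sigma> * (solution 1 x + of_real c * x ^ Suc p / of_nat (Suc p))"
      by (simp add: i_def \<kappa>_def field_simps)
    then show ?thesis using K'(2)[OF that] \<sigma> by (simp only: norm_mult norm_of_real)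
  qed
  have ri: "i x \<in> \<real>" if "x \<in> ball 0 \<delta>" "x \<in> \<real>" for x
    using solution_admissible that unfolding i_def admissible_def by (intro Reals_mult) auto
  have ev: "even (Suc p)" using p by simp
  let ?P = "\<lambda>\<phi> x. \<exists>x'. \<phi> (of_real x) = (of_real x' :: complex) \<and> \<bar>x'\<bar> < \<delta> \<and> x * x' < 0 \<and>
      i (of_real x') = i (of_real x) \<and> 0 < Re (i (of_real x))"
  have "\<exists>\<epsilon> \<phi>. 0 < \<epsilon> \<and> \<epsilon> \<le> \<delta> \<and> \<phi> holomorphic_on ball 0 \<epsilon> \<and> \<phi> 0 = 0 \<and>
      (\<forall>x. x \<noteq> 0 \<longrightarrow> \<bar>x\<bar> < \<epsilon> \<longrightarrow> ?P \<phi> x)"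
  proof (rule even_order_level_involution[OF \<delta>(1) hi zero_less_Suc ev \<kappa> K'(1)])
    show "norm (i x - of_real \<kappa> * x ^ Suc p) \<le> K' * norm x ^ Suc (Suc p)" if "x \<in> ball 0 \<delta>" for x
      by (rule asym[OF that])
    show "i x \<in> \<real>" if "x \<in> ball 0 \<delta>" "x \<in> \<real>" for x
      by (rule ri[OF that])
    fix \<epsilon> \<phi>
    assume *: "0 < \<epsilon>" "\<epsilon> \<le> \<delta>" "\<phi> holomorphic_on ball 0 \<epsilon>" "\<phi> 0 = 0"
      and P: "\<And>x. x \<noteq> 0 \<Longrightarrow> \<bar>x\<bar> < \<epsilon> \<Longrightarrow> ?P \<phi> x"
    have "\<forall>x. x \<noteq> 0 \<longrightarrow> \<bar>x\<bar> < \<epsilon> \<longrightarrow> ?P \<phi> x" by (intro allI impI P)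
    then show ?thesis using * by blast
  qed
  then obtain \<epsilon> \<phi> where \<epsilon>: "0 < \<epsilon>" "\<epsilon> \<le> \<delta>" and \<phi>: "\<phi> holomorphic_on ball 0 \<epsilon>" "\<phi> 0 = 0"
    and inv: "\<And>x. x \<noteq> 0 \<Longrightarrow> \<bar>x\<bar> < \<epsilon> \<Longrightarrow> ?P \<phi> x"
    by blast
  have gr: "f (of_real u) (of_real v) = of_real (g u v)" if "\<bar>u\<bar> < r" "\<bar>v\<bar> < r" for u v
    using g that r(2) by auto
  have Re_i: "Re (i z) = \<sigma> * Re (solution 1 z)" for z by (simp add: i_def)
  have "g x 0 \<noteq> 0 \<and> (\<exists>x' \<eta>. \<phi> (of_real x) = of_real x' \<and> x \<noteq> x' \<and> graph_arc g \<sigma> B x x' \<eta>)"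
    if x: "x \<noteq> 0" "\<bar>x\<bar> < \<epsilon>" for x
  proof -
    obtain x' where x': "\<phi> (of_real x) = of_real x'" "\<bar>x'\<bar> < \<delta>" "x * x' < 0"
      "i (of_real x') = i (of_real x)" "0 < Re (i (of_real x))"
      using inv[OF x] by blast
    have x\<delta>: "\<bar>x\<bar> < \<delta>" using x \<epsilon> by simp
    have "x' \<noteq> 0" "x \<noteq> x'" using x'(3) by (auto simp: mult_less_0_iff)
    have s: "0 < \<sigma> * Re (solution 1 (of_real x))" "0 < \<sigma> * Re (solution 1 (of_real x'))"
      using x'(4,5) Re_i by metis+
    obtain \<eta> where \<eta>: "\<eta> x = 0" "\<eta> 0 = Re (solution 1 (of_real x))"
      "\<And>\<xi>. \<xi> \<in> closed_segment x 0 \<Longrightarrow> \<bar>\<eta> \<xi>\<bar> < r \<and>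
        (\<eta> has_real_derivative g \<xi> (\<eta> \<xi>)) (at \<xi> within closed_segment x 0)"
      "\<And>\<xi>. \<xi> \<in> closed_segment x 0 \<Longrightarrow> \<xi> \<noteq> x \<Longrightarrow> 0 < \<sigma> * \<eta> \<xi>"
      using half_arc[OF x(1) x\<delta> gr sgn s(1)] by blast
    obtain \<theta> where \<theta>: "\<theta> x' = 0" "\<theta> 0 = Re (solution 1 (of_real x'))"
      "\<And>\<xi>. \<xi> \<in> closed_segment x' 0 \<Longrightarrow> \<bar>\<theta> \<xi>\<bar> < r \<and>
        (\<theta> has_real_derivative g \<xi> (\<theta> \<xi>)) (at \<xi> within closed_segment x' 0)"
      "\<And>\<xi>. \<xi> \<in> closed_segment x' 0 \<Longrightarrow> \<xi> \<noteq> x' \<Longrightarrow> 0 < \<sigma> * \<theta> \<xi>"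
      using half_arc[OF \<open>x' \<noteq> 0\<close> x'(2) gr sgn s(2)] by blast
    have "\<sigma> * Re (solution 1 (of_real x)) = \<sigma> * Re (solution 1 (of_real x'))"
      using x'(4) Re_i by metis
    then have "\<eta> 0 = \<theta> 0" using \<sigma> \<eta>(2) \<theta>(2) by auto
    moreover have "\<bar>x\<bar> < B" "\<bar>x'\<bar> < B" using x\<delta> x'(2) \<delta>B B'(2) by auto
    ultimately have "graph_arc g \<sigma> B x x' (\<lambda>\<xi>. if \<xi> \<in> closed_segment x 0 then \<eta> \<xi> else \<theta> \<xi>)"
      using rB by (intro graph_arc_glue[OF x'(3) _ _ _ _ \<eta>(1,3,4) \<theta>(1,3,4)]) auto
    moreover have "g x 0 \<noteq> 0" using sgn[OF x(1) x\<delta>] by auto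
    ultimately show ?thesis using x'(1) \<open>x \<noteq> x'\<close> by blast
  qed
  from that[OF \<epsilon>(1) \<phi> this] show ?thesis .
qed

section \<open>Orbits as time-parametrised arcs\<close>

text \<open>Separation of variables: time as a function of position is an antiderivative of
  \<open>1 / Q\<close>, strictly monotone because \<open>Q\<close> has no zero, and the flow is its
  inverse. \<open>T\<close> comes out negative when \<open>Q\<close> points from \<open>x'\<close>
  towards \<open>x\<close>.\<close>

lemma autonomous_scalar_flow:
  fixes Q :: "real \<Rightarrow> real"
  assumes ne: "x \<noteq> x'" and Q: "continuous_on (closed_segment x x') Q"
    and nz: "\<And>\<xi>. \<xi> \<in> closed_segment x x' \<Longrightarrow> Q \<xi> \<noteq> 0"
  obtains T \<Xi> where "T \<noteq> 0" "\<Xi> 0 = x" "\<Xi> T = x'" "\<Xi> ` closed_segment 0 T \<subseteq> closed_segment x x'"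
    "\<Xi> ` open_segment 0 T \<subseteq> open_segment x x'"
    "\<forall>t \<in> closed_segment 0 T. (\<Xi> has_real_derivative Q (\<Xi> t)) (at t)"
proof -
  define a where "a = min x x'"
  define b where "b = max x x'"
  have seg: "closed_segment x x' = {a..b}" by (auto simp: a_def b_def closed_segment_eq_real_ivl)
  have ab: "a < b" using ne by (auto simp: a_def b_def)
  \<comment> \<open>Clamping the argument extends \<open>1 / Q\<close> continuously beyond the
    segment, so that the antiderivative has two-sided derivatives at \<open>x\<close> and
    \<open>x'\<close> too, as the inverse function rule requires.\<close>
  define q where "q \<xi> = inverse (Q (max a (min b \<xi>)))" for \<xi>
  have cl: "max a (min b \<xi>) \<in> closed_segment x x'" for \<xi> using ab seg by auto
  have "continuous_on UNIV (\<lambda>\<xi>. Q (max a (min b \<xi>)))"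
    by (rule continuous_on_compose2[OF Q]) (use cl in \<open>auto intro!: continuous_intros\<close>)
  then have cq: "continuous_on UNIV q"
    unfolding q_def using nz cl by (intro continuous_on_inverse) auto
  have qnz: "q \<xi> \<noteq> 0" for \<xi> using nz[OF cl] by (simp add: q_def)
  have qQ: "inverse (q \<xi>) = Q \<xi>" if "\<xi> \<in> closed_segment x x'" for \<xi>
    using that seg by (simp add: q_def)
  have cq': "continuous_on {a - 1..b + 1} q" using cq by (rule continuous_on_subset) auto
  obtain G where G: "\<And>\<xi>. \<xi> \<in> {a - 1..b + 1} \<Longrightarrow>
      (G has_vector_derivative q \<xi>) (at \<xi> within {a - 1..b + 1})"
    using antiderivative_continuous[OF cq'] by blast
  define S where "S = {a - 1<..<b + 1}"
  define \<tau> where "\<tau> \<xi> = G \<xi> - G x" for \<xi>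
  have segS: "closed_segment x x' \<subseteq> S" using seg by (auto simp: S_def)
  have d\<tau>: "(\<tau> has_real_derivative q \<xi>) (at \<xi>)" if "\<xi> \<in> S" for \<xi>
  proof -
    have "at \<xi> within {a - 1..b + 1} = at \<xi>"
      using that by (intro at_within_interior) (simp add: S_def)
    then have "(G has_real_derivative q \<xi>) (at \<xi>)"
      using G[of \<xi>] that by (simp add: S_def has_real_derivative_iff_has_vector_derivative)
    then show ?thesis unfolding \<tau>_def by (auto intro!: derivative_eq_intros)
  qed
  have c\<tau>: "continuous_on S \<tau>"
    using d\<tau> by (intro continuous_at_imp_continuous_on ballI) (meson DERIV_isCont)
  have less: "\<tau> u \<noteq> \<tau> v" if uv: "u < v" "u \<in> S" "v \<in> S" for u v
  proof -
    have "\<exists>z>u. z < v \<and> \<tau> v - \<tau> u = (v - u) * q z"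
      by (rule MVT2[OF uv(1)]) (use uv(2,3) in \<open>auto intro!: d\<tau> simp: S_def\<close>)
    then show ?thesis using qnz uv(1) by auto
  qed
  have inj: "inj_on \<tau> S"
    by (rule linorder_inj_onI) (use less in auto)
  define \<Xi> where "\<Xi> = inv_into S \<tau>"
  define T where "T = \<tau> x'"
  have \<Xi>\<tau>: "\<Xi> (\<tau> \<xi>) = \<xi>" if "\<xi> \<in> S" for \<xi>
    unfolding \<Xi>_def using inj that by (rule inv_into_f_f)
  have xS: "x \<in> S" "x' \<in> S" using segS by auto
  have \<tau>x: "\<tau> x = 0" by (simp add: \<tau>_def)
  have c\<tau>': "continuous_on (closed_segment x x') \<tau>" using c\<tau> segS continuous_on_subset by blast
  have inj': "inj_on \<tau> (closed_segment x x')" using inj segS inj_on_subset by blast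
  have im: "\<tau> ` closed_segment x x' = closed_segment 0 T" "\<tau> ` open_segment x x' = open_segment 0 T"
    using continuous_injective_image_segment_1[OF c\<tau>' inj']
      continuous_injective_image_open_segment_1[OF c\<tau>' inj'] by (simp_all add: \<tau>x T_def)
  have "T \<noteq> 0" using inj_onD[OF inj _ xS] ne by (auto simp: T_def \<tau>x)
  moreover have "\<Xi> 0 = x" using \<Xi>\<tau>[OF xS(1)] by (simp add: \<tau>x)
  moreover have "\<Xi> T = x'" using \<Xi>\<tau>[OF xS(2)] by (simp add: T_def)
  moreover have "\<Xi> ` closed_segment 0 T \<subseteq> closed_segment x x'"
    unfolding im(1)[symmetric] using \<Xi>\<tau> segS by auto
  moreover have "\<Xi> ` open_segment 0 T \<subseteq> open_segment x x'"
    unfolding im(2)[symmetric] using \<Xi>\<tau> segS by (auto simp: open_segment_def subset_iff)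
  moreover have "\<forall>t \<in> closed_segment 0 T. (\<Xi> has_real_derivative Q (\<Xi> t)) (at t)"
  proof
    fix t
    assume "t \<in> closed_segment 0 T"
    then obtain \<xi> where \<xi>: "\<xi> \<in> closed_segment x x'" "t = \<tau> \<xi>" using im(1) by blast
    have \<xi>S: "\<xi> \<in> S" using \<xi>(1) segS by blast
    have "open S" by (simp add: S_def)
    from has_field_derivative_inverse_strong[OF d\<tau>[OF \<xi>S] qnz this \<xi>S c\<tau> \<Xi>\<tau>]
    show "(\<Xi> has_real_derivative Q (\<Xi> t)) (at t)"
      using \<Xi>\<tau>[OF \<xi>S] \<xi> qQ by simp
  qed
  ultimately show ?thesis by (rule that)
qed

text \<open>The set of times of agreement is closed and open in the connected set \<open>I\<close>.
  Only \<open>\<gamma>\<close> is assumed to stay in \<open>B\<close>: near a time of agreement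
  continuity keeps \<open>\<theta>\<close> there as well.\<close>

lemma ode_solutions_agree:
  fixes \<gamma> \<theta> :: "real \<Rightarrow> 'a :: real_normed_vector"
  assumes B: "open B" and L: "0 \<le> L"
    and lip: "\<And>p q. p \<in> B \<Longrightarrow> q \<in> B \<Longrightarrow> norm (F p - F q) \<le> L * norm (p - q)"
    and I: "compact I" "convex I"
    and \<gamma>B: "\<And>t. t \<in> I \<Longrightarrow> \<gamma> t \<in> B"
    and \<gamma>: "\<And>t. t \<in> I \<Longrightarrow> (\<gamma> has_vector_derivative F (\<gamma> t)) (at t within I)"
    and \<theta>: "\<And>t. t \<in> I \<Longrightarrow> (\<theta> has_vector_derivative F (\<theta> t)) (at t within I)"
    and t0: "t0 \<in> I" "\<gamma> t0 = \<theta> t0" and t: "t \<in> I"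
  shows "\<gamma> t = \<theta> t"
proof -
  define u where "u t = \<gamma> t - \<theta> t" for t
  have du: "(u has_vector_derivative F (\<gamma> t) - F (\<theta> t)) (at t within I)" if "t \<in> I" for t
    unfolding u_def by (rule has_vector_derivative_diff[OF \<gamma>[OF that] \<theta>[OF that]])
  have cu: "continuous_on I u"
    by (rule continuous_on_vector_derivative[OF du])
  have c\<theta>: "continuous_on I \<theta>"
    by (rule continuous_on_vector_derivative[OF \<theta>])
  let ?E = "{t \<in> I. u t = 0}"
  have "closedin (top_of_set I) ?E" by (rule continuous_closedin_preimage_constant[OF cu])
  moreover have "openin (top_of_set I) ?E"
    unfolding openin_contains_ball
  proof (intro conjI ballI)
    fix t1
    assume t1: "t1 \<in> ?E"
    then have "\<theta> t1 \<in> B" using \<gamma>B[of t1] by (simp add: u_def)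
    then obtain e where e: "0 < e" "ball (\<theta> t1) e \<subseteq> B" by (rule openE[OF B])
    obtain d where d: "0 < d" "\<And>t. t \<in> I \<Longrightarrow> dist t t1 < d \<Longrightarrow> dist (\<theta> t) (\<theta> t1) < e"
      using c\<theta> t1 e(1) unfolding continuous_on_iff by blast
    \<comment> \<open>On an interval of radius \<open>c\<close> the maximum of
      \<open>norm (u t)\<close> is at most \<open>L * c \<le> 1 / 2\<close> times itself, hence
      zero.\<close>
    define c where "c = min (d / 2) (1 / (2 * (L + 1)))"
    have c: "0 < c" "c < d" "c \<le> 1 / (2 * (L + 1))" using d L by (auto simp: c_def)
    have "L * c \<le> (L + 1) * (1 / (2 * (L + 1)))" using c L by (intro mult_mono) auto
    also have "\<dots> = 1 / 2" using L by (simp add: field_simps)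
    finally have Lc: "L * c \<le> 1 / 2" .
    let ?J = "I \<inter> cball t1 c"
    have J: "compact ?J" "convex ?J" "t1 \<in> ?J"
      using I t1 c by (auto intro: compact_Int convex_Int)
    have "continuous_on ?J (\<lambda>t. norm (u t))"
      by (intro continuous_on_norm continuous_on_subset[OF cu]) auto
    from continuous_attains_sup[OF J(1) _ this] J(3) obtain s where
      s: "s \<in> ?J" "\<And>t. t \<in> ?J \<Longrightarrow> norm (u t) \<le> norm (u s)" by blast
    have "norm (u s - u t1) \<le> (L * norm (u s)) * norm (s - t1)"
    proof (rule differentiable_bound[OF J(2) _ _ s(1) J(3)])
      fix t
      assume tJ: "t \<in> ?J"
      show "(u has_derivative (\<lambda>h. h *\<^sub>R (F (\<gamma> t) - F (\<theta> t)))) (at t within ?J)"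
        using has_vector_derivative_within_subset[OF du, of t ?J] tJ
        by (auto simp: has_vector_derivative_def)
      have "\<theta> t \<in> B" using d(2)[of t] tJ c(2) e(2) by (auto simp: dist_commute subset_iff)
      then have "norm (F (\<gamma> t) - F (\<theta> t)) \<le> L * norm (u t)"
        unfolding u_def using tJ \<gamma>B by (intro lip) auto
      also have "\<dots> \<le> L * norm (u s)" using s(2)[OF tJ] L by (rule mult_left_mono)
      finally show "onorm (\<lambda>h. h *\<^sub>R (F (\<gamma> t) - F (\<theta> t))) \<le> L * norm (u s)"
        by (intro onorm_le) (simp add: mult.commute mult_left_mono)
    qed
    also have "\<dots> \<le> (L * norm (u s)) * c"
      using s(1) L by (intro mult_left_mono) (auto simp: dist_norm norm_minus_commute)
    also have "\<dots> = (L * c) * norm (u s)" by simp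
    also have "\<dots> \<le> (1 / 2) * norm (u s)" by (rule mult_right_mono[OF Lc]) simp
    finally have "norm (u s) \<le> 0" using t1 by simp
    then have "u t = 0" if "t \<in> ?J" for t using s(2)[OF that] by simp
    with c(1) show "\<exists>e>0. ball t1 e \<inter> I \<subseteq> ?E" by (intro exI[of _ c]) auto
  qed auto
  moreover have "connected I" using I(2) by (rule convex_connected)
  ultimately have "?E = {} \<or> ?E = I" by (auto simp: connected_clopen)
  moreover have "t0 \<in> ?E" using t0 by (simp add: u_def)
  ultimately have "t \<in> ?E" using t by blast
  then show ?thesis by (simp add: u_def)
qed

text \<open>Transversality at the start decides whether the half-plane is entered forward or
  backward in time. Two return arcs from the same point therefore run in the same time
  direction.\<close>

lemma entry_direction:
  fixes y :: "real \<Rightarrow> real"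
  assumes T: "T \<noteq> 0" and y: "(y has_real_derivative d) (at 0 within closed_segment 0 T)"
    and y0: "y 0 = 0" and d: "d \<noteq> 0" and pos: "\<And>t. t \<in> open_segment 0 T \<Longrightarrow> 0 < y t"
  shows "0 < T * d"
proof (rule ccontr)
  assume "\<not> 0 < T * d"
  then consider "0 < T" "d < 0" | "T < 0" "0 < d"
    using T d by (auto simp: zero_less_mult_iff not_less mult_le_0_iff)
  then show False
  proof cases
    case 1
    obtain e where e: "0 < e"
      "\<And>h. 0 < h \<Longrightarrow> 0 + h \<in> closed_segment 0 T \<Longrightarrow> h < e \<Longrightarrow> y (0 + h) < y 0"
      using has_real_derivative_neg_dec_right[OF y 1(2)] by blast
    define h where "h = min (e / 2) (T / 2)"
    have h: "0 < h" "h < e" "h < T" using e 1 by (auto simp: h_def)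
    then have "y h < 0" using e(2)[of h] y0 by (simp add: closed_segment_eq_real_ivl)
    moreover have "0 < y h" using h by (intro pos) (simp add: open_segment_eq_real_ivl)
    ultimately show False by simp
  next
    case 2
    obtain e where e: "0 < e"
      "\<And>h. 0 < h \<Longrightarrow> 0 - h \<in> closed_segment 0 T \<Longrightarrow> h < e \<Longrightarrow> y (0 - h) < y 0"
      using has_real_derivative_pos_inc_left[OF y 2(2)] by blast
    define h where "h = min (e / 2) (- T / 2)"
    have h: "0 < h" "h < e" "h < - T" using e 2 by (auto simp: h_def)
    then have "y (- h) < 0" using e(2)[of h] y0 2 by (simp add: closed_segment_eq_real_ivl)
    moreover have "0 < y (- h)" using h 2 by (intro pos) (simp add: open_segment_eq_real_ivl)
    ultimately show False by simp
  qed
qed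

text \<open>The witnesses \<open>T\<close> and \<open>\<gamma>\<close> of
  \<open>first_return\<close> are exposed so that two arcs can be compared.\<close>

definition return_arc ::
    "(real \<times> real) set \<Rightarrow> real \<Rightarrow> (real \<times> real \<Rightarrow> real \<times> real) \<Rightarrow> real \<Rightarrow> real \<Rightarrow>
     real \<Rightarrow> (real \<Rightarrow> real \<times> real) \<Rightarrow> bool" where
  "return_arc D \<sigma> F x x' T \<gamma> \<longleftrightarrow> T \<noteq> 0 \<and>
     (\<forall>t\<in>closed_segment 0 T. \<gamma> t \<in> D \<and>
        (\<gamma> has_vector_derivative F (\<gamma> t)) (at t within closed_segment 0 T)) \<and>
     \<gamma> 0 = (x, 0) \<and> \<gamma> T = (x', 0) \<and> (\<forall>t\<in>open_segment 0 T. 0 < \<sigma> * snd (\<gamma> t))"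

lemma first_return_iff: "first_return D {p. 0 < \<sigma> * snd p} F x x' \<longleftrightarrow> (\<exists>T \<gamma>. return_arc D \<sigma> F x x' T \<gamma>)"
  by (simp add: first_return_def return_arc_def)

lemma return_arc_direction:
  assumes arc: "return_arc D \<sigma> F x x' T \<gamma>" and \<sigma>: "\<sigma> \<noteq> 0" and F: "snd (F (x, 0)) \<noteq> 0"
  shows "0 < T * (\<sigma> * snd (F (x, 0)))"
proof (rule entry_direction)
  have "(\<gamma> has_vector_derivative F (x, 0)) (at 0 within closed_segment 0 T)"
    using arc unfolding return_arc_def by (metis ends_in_segment(1))
  then have "((\<lambda>t. snd (\<gamma> t)) has_vector_derivative snd (F (x, 0))) (at 0 within closed_segment 0 T)"
    by (rule bounded_linear.has_vector_derivative[OF bounded_linear_snd])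
  then show "((\<lambda>t. \<sigma> * snd (\<gamma> t)) has_real_derivative \<sigma> * snd (F (x, 0))) (at 0 within closed_segment 0 T)"
    unfolding has_real_derivative_iff_has_vector_derivative[symmetric] by (rule DERIV_cmult)
qed (use arc \<sigma> F in \<open>auto simp: return_arc_def\<close>)

text \<open>The arcs agree for as long as both last. If one ended earlier, its end on the axis would
  be an interior point of the other, which lies strictly in the half-plane; so the return times
  coincide. The Lipschitz bound is needed only around the first arc, and the second may lie anywhere
  in \<open>D\<close>.\<close>

lemma return_arc_unique:
  assumes B: "open B" and L: "0 \<le> L"
    and lip: "\<And>p q. p \<in> B \<Longrightarrow> q \<in> B \<Longrightarrow> norm (F p - F q) \<le> L * norm (p - q)"
    and arc: "return_arc B \<sigma> F x x' T \<gamma>" and arc2: "return_arc D \<sigma> F x x'' S \<theta>"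
    and \<sigma>: "\<sigma> \<noteq> 0" and F: "snd (F (x, 0)) \<noteq> 0"
  shows "x'' = x'"
proof -
  have "0 < T * d \<Longrightarrow> 0 < S * d \<Longrightarrow> 0 < T * S" for d
    by (auto simp: zero_less_mult_iff)
  then have TS: "0 < T * S"
    using return_arc_direction[OF arc \<sigma> F] return_arc_direction[OF arc2 \<sigma> F] .
  have agree: "\<gamma> t = \<theta> t"
    if sub: "closed_segment 0 U \<subseteq> closed_segment 0 T" "closed_segment 0 U \<subseteq> closed_segment 0 S"
      and t: "t \<in> closed_segment 0 U" for U t
  proof (rule ode_solutions_agree[OF B L lip, of "closed_segment 0 U" _ _ 0])
    show "\<gamma> t \<in> B" if "t \<in> closed_segment 0 U" for t
      using arc sub that by (auto simp: return_arc_def)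
    show "(\<gamma> has_vector_derivative F (\<gamma> t)) (at t within closed_segment 0 U)"
      if "t \<in> closed_segment 0 U" for t
      using arc sub that by (auto simp: return_arc_def intro: has_vector_derivative_within_subset)
    show "(\<theta> has_vector_derivative F (\<theta> t)) (at t within closed_segment 0 U)"
      if "t \<in> closed_segment 0 U" for t
      using arc2 sub that by (auto simp: return_arc_def intro: has_vector_derivative_within_subset)
    show "\<gamma> 0 = \<theta> 0" using arc arc2 by (simp add: return_arc_def)
  qed (use t in auto)
  have "S = T \<or> S \<in> open_segment 0 T \<or> T \<in> open_segment 0 S"
    using TS by (cases S T rule: linorder_cases)
      (auto simp: open_segment_eq_real_ivl zero_less_mult_iff)
  then consider "S = T" | "S \<in> open_segment 0 T" | "T \<in> open_segment 0 S" by blast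
  then show ?thesis
  proof cases
    case 1
    then show ?thesis using agree[of T T] arc arc2 by (simp add: return_arc_def)
  next
    case 2
    then have "closed_segment 0 S \<subseteq> closed_segment 0 T"
      by (simp add: open_segment_def subset_closed_segment)
    then have "\<gamma> S = \<theta> S" using agree[of S S] by simp
    then show ?thesis using arc arc2 2 by (force simp: return_arc_def)
  next
    case 3
    then have "closed_segment 0 T \<subseteq> closed_segment 0 S"
      by (simp add: open_segment_def subset_closed_segment)
    then have "\<gamma> T = \<theta> T" using agree[of T T] by simp
    then show ?thesis using arc arc2 3 by (force simp: return_arc_def)
  qed
qed

text \<open>The graph is traversed with horizontal speed \<open>fst F\<close>; the chain rule then
  gives the vertical speed \<open>snd F\<close>, since the slope is their quotient.\<close>

lemma graph_arc_imp_return_arc: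
  assumes ne: "x \<noteq> x'" and arc: "graph_arc (\<lambda>u v. snd (F (u, v)) / fst (F (u, v))) \<sigma> B x x' \<eta>"
    and cont: "continuous_on D F" and D: "\<And>u v. \<bar>u\<bar> < B \<Longrightarrow> \<bar>v\<bar> < B \<Longrightarrow> (u, v) \<in> D"
    and nz: "\<And>p. p \<in> D \<Longrightarrow> fst (F p) \<noteq> 0"
  obtains T \<gamma> where "return_arc D \<sigma> F x x' T \<gamma>"
proof -
  let ?g = "\<lambda>u v. snd (F (u, v)) / fst (F (u, v))"
  note arc' = arc[unfolded graph_arc_def]
  have d\<eta>: "(\<eta> has_real_derivative ?g \<xi> (\<eta> \<xi>)) (at \<xi> within closed_segment x x')"
    and inD: "(\<xi>, \<eta> \<xi>) \<in> D" if "\<xi> \<in> closed_segment x x'" for \<xi>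
    using arc' that by (blast intro: D)+
  have "continuous_on (closed_segment x x') \<eta>"
    by (rule DERIV_continuous_on[OF d\<eta>])
  then have cF: "continuous_on (closed_segment x x') (\<lambda>\<xi>. F (\<xi>, \<eta> \<xi>))"
    by (intro continuous_on_compose2[OF cont] continuous_intros) (use inD in auto)
  obtain T \<Xi> where T: "T \<noteq> 0" and \<Xi>: "\<Xi> 0 = x" "\<Xi> T = x'"
    "\<Xi> ` closed_segment 0 T \<subseteq> closed_segment x x'" "\<Xi> ` open_segment 0 T \<subseteq> open_segment x x'"
    and d\<Xi>: "\<forall>t \<in> closed_segment 0 T. (\<Xi> has_real_derivative fst (F (\<Xi> t, \<eta> (\<Xi> t)))) (at t)"
    by (rule autonomous_scalar_flow[OF ne continuous_on_fst[OF cF] nz[OF inD]])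
  define \<gamma> where "\<gamma> t = (\<Xi> t, \<eta> (\<Xi> t))" for t
  have "(\<gamma> has_vector_derivative F (\<gamma> t)) (at t within closed_segment 0 T)"
    if t: "t \<in> closed_segment 0 T" for t
  proof -
    have \<Xi>t: "\<Xi> t \<in> closed_segment x x'" using \<Xi>(3) t by blast
    have 1: "(\<Xi> has_real_derivative fst (F (\<gamma> t))) (at t within closed_segment 0 T)"
      using bspec[OF d\<Xi> t] by (simp add: \<gamma>_def has_field_derivative_at_within)
    have "(\<eta> has_real_derivative ?g (\<Xi> t) (\<eta> (\<Xi> t))) (at (\<Xi> t) within \<Xi> ` closed_segment 0 T)"
      by (rule has_field_derivative_subset[OF d\<eta>[OF \<Xi>t] \<Xi>(3)])
    from DERIV_image_chain[OF this 1]
    have "((\<lambda>t. \<eta> (\<Xi> t)) has_real_derivative ?g (\<Xi> t) (\<eta> (\<Xi> t)) * fst (F (\<gamma> t))) (at t within closed_segment 0 T)"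
      by (simp add: o_def)
    then have 2: "((\<lambda>t. \<eta> (\<Xi> t)) has_real_derivative snd (F (\<gamma> t))) (at t within closed_segment 0 T)"
      using nz[OF inD[OF \<Xi>t]] by (simp add: \<gamma>_def)
    show ?thesis
      using has_vector_derivative_Pair[OF 1[unfolded has_real_derivative_iff_has_vector_derivative]
          2[unfolded has_real_derivative_iff_has_vector_derivative]]
      by (simp add: \<gamma>_def[abs_def])
  qed
  moreover have "0 < \<sigma> * snd (\<gamma> t)" if "t \<in> open_segment 0 T" for t
    unfolding \<gamma>_def snd_conv using arc' \<Xi>(4) that by blast
  moreover have "\<gamma> t \<in> D" if "t \<in> closed_segment 0 T" for t
    unfolding \<gamma>_def using \<Xi>(3) that by (intro inD) blast
  moreover have "\<gamma> 0 = (x, 0)" "\<gamma> T = (x', 0)"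
    using arc' \<Xi>(1,2) by (simp_all add: \<gamma>_def)
  ultimately have "return_arc D \<sigma> F x x' T \<gamma>" using T by (simp add: return_arc_def)
  then show ?thesis by (rule that)
qed

text \<open>At a real centre the real parts of the complex Taylor coefficients serve, because the
  powers of a real \<open>u\<close> and the sum are real.\<close>

lemma real_analytic_on_real_trace:
  assumes hol: "\<phi> holomorphic_on ball 0 \<epsilon>"
    and h: "\<And>x. \<bar>x\<bar> < \<epsilon> \<Longrightarrow> \<phi> (of_real x) = of_real (h x)"
  shows "real_analytic_on h {- \<epsilon><..<\<epsilon>}"
  unfolding real_analytic_on_def
proof
  fix a
  assume a: "a \<in> {- \<epsilon><..<\<epsilon>}"
  define r where "r = \<epsilon> - \<bar>a\<bar>"
  have r: "0 < r" using a by (auto simp: r_def)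
  have "ball (of_real a) r \<subseteq> ball (0 :: complex) \<epsilon>"
    by (auto simp: r_def ball_subset_ball_iff dist_norm)
  then have hol': "\<phi> holomorphic_on ball (of_real a) r" using hol holomorphic_on_subset by blast
  let ?c = "\<lambda>n. (deriv ^^ n) \<phi> (of_real a) / fact n"
  have "(\<lambda>n. Re (?c n) * u ^ n) sums h (a + u)" if u: "\<bar>u\<bar> < r" for u
  proof -
    have "of_real (a + u) \<in> ball (of_real a :: complex) r"
      using u by (simp add: dist_norm)
    from holomorphic_power_series[OF hol' this]
    have "(\<lambda>n. ?c n * of_real u ^ n) sums \<phi> (of_real (a + u))" by simp
    then have "(\<lambda>n. Re (?c n * of_real u ^ n)) sums Re (\<phi> (of_real (a + u)))" by (rule sums_Re)
    moreover have "Re (w * of_real b) = Re w * b" for w b by simp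
    then have "(\<lambda>n. Re (?c n * of_real u ^ n)) = (\<lambda>n. Re (?c n) * u ^ n)"
      by (simp only: of_real_power[symmetric])
    moreover have "\<phi> (of_real (a + u)) = of_real (h (a + u))"
      using u by (intro h) (auto simp: r_def)
    ultimately show ?thesis by (simp only: Re_complex_of_real)
  qed
  with r show "\<exists>r>0. \<exists>c. \<forall>u. \<bar>u\<bar> < r \<longrightarrow> (\<lambda>n. c n * u ^ n) sums h (a + u)"
    by (intro exI[of _ r] conjI exI[of _ "\<lambda>n. Re (?c n)"] allI impI)
qed

section \<open>Analyticity of the half-return map\<close>

text \<open>One variable is moved at a time; the estimate in the first is that in the second for the
  swapped function.\<close>

lemma complexifies_Lipschitz:
  assumes G: "complexifies R G g" and s: "0 < s" "s < R"
  obtains L where "0 < L" "\<And>u v u' v'. \<bar>u\<bar> < s \<Longrightarrow> \<bar>v\<bar> < s \<Longrightarrow> \<bar>u'\<bar> < s \<Longrightarrow> \<bar>v'\<bar> < s \<Longrightarrow>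
    \<bar>g (u, v) - g (u', v')\<bar> \<le> L * (\<bar>u - u'\<bar> + \<bar>v - v'\<bar>)"
proof -
  have G2: "holo2 R G" using G by (simp add: complexifies_def)
  obtain L1 where L1: "0 < L1" "\<And>u v w. u \<in> cball 0 s \<Longrightarrow> v \<in> cball 0 s \<Longrightarrow> w \<in> cball 0 s \<Longrightarrow>
      norm (G u v - G u w) \<le> L1 * norm (v - w)"
    using holo2_Lipschitz_snd[OF G2 s] by blast
  obtain L2 where L2: "0 < L2" "\<And>u v w. u \<in> cball 0 s \<Longrightarrow> v \<in> cball 0 s \<Longrightarrow> w \<in> cball 0 s \<Longrightarrow>
      norm (G v u - G w u) \<le> L2 * norm (v - w)"
    using holo2_Lipschitz_snd[OF holo2_swap[OF G2] s] by blast
  have "\<bar>g (u, v) - g (u', v')\<bar> \<le> (L1 + L2) * (\<bar>u - u'\<bar> + \<bar>v - v'\<bar>)"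
    if uv: "\<bar>u\<bar> < s" "\<bar>v\<bar> < s" "\<bar>u'\<bar> < s" "\<bar>v'\<bar> < s" for u v u' v'
  proof -
    have e: "G (of_real a) (of_real b) = of_real (g (a, b))" if "\<bar>a\<bar> < s" "\<bar>b\<bar> < s" for a b
      using G that s by (simp add: complexifies_def)
    have 1: "\<bar>g (u, v) - g (u, v')\<bar> \<le> L1 * \<bar>v - v'\<bar>"
      using L1(2)[of "of_real u" "of_real v" "of_real v'"] e uv
      by (simp flip: of_real_diff)
    have 2: "\<bar>g (u, v') - g (u', v')\<bar> \<le> L2 * \<bar>u - u'\<bar>"
      using L2(2)[of "of_real v'" "of_real u" "of_real u'"] e uv
      by (simp flip: of_real_diff)
    have "L1 * \<bar>v - v'\<bar> + L2 * \<bar>u - u'\<bar> \<le> (L1 + L2) * \<bar>v - v'\<bar> + (L1 + L2) * \<bar>u - u'\<bar>"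
      using L1(1) L2(1) by (intro add_mono mult_right_mono) auto
    moreover have "\<bar>g (u, v) - g (u', v')\<bar> \<le> \<bar>g (u, v) - g (u, v')\<bar> + \<bar>g (u, v') - g (u', v')\<bar>"
      by linarith
    ultimately show ?thesis using 1 2 by (simp add: distrib_left)
  qed
  moreover have "0 < L1 + L2" using L1(1) L2(1) by simp
  ultimately show ?thesis using that by blast
qed

lemma half_return_analytic:
  assumes D: "open D" "(0, 0) \<in> D" and F: "analytic_vector_field_on F D" and k: "0 < k"
    and contact: "contact_of_multiplicity F (2 * k)" and \<sigma>: "\<bar>\<sigma>\<bar> = 1"
    and invis: "\<sigma> * iterated_lie_derivative F (2 * k) snd (0, 0) < 0"
  shows "half_return_analytic_near_0 D {p. 0 < \<sigma> * snd p} F"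
proof -
  obtain r1 X where X1: "0 < r1" "complexifies r1 X (\<lambda>p. fst (F p))"
    using real_analytic_on2_complexify[of "\<lambda>p. fst (F p)" D] F D
    unfolding analytic_vector_field_on_def by blast
  obtain r2 Y where Y1: "0 < r2" "complexifies r2 Y (\<lambda>p. snd (F p))"
    using real_analytic_on2_complexify[of "\<lambda>p. snd (F p)" D] F D
    unfolding analytic_vector_field_on_def by blast
  define r where "r = min r1 r2"
  have r: "0 < r" using X1 Y1 by (simp add: r_def)
  have X: "complexifies r X (\<lambda>p. fst (F p))"
    using complexifies_mono[OF X1(2)] by (simp add: r_def)
  have Y: "complexifies r Y (\<lambda>p. snd (F p))"
    using complexifies_mono[OF Y1(2)] by (simp add: r_def)
  let ?V = "iterated_lie_derivative F (2 * k) snd (0, 0)"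
  obtain p where p: "2 * k = Suc p" "odd p" using k by (cases k) auto
  obtain a \<rho> where \<rho>: "0 < \<rho>" "\<rho> \<le> r" and a: "a holomorphic_on ball 0 \<rho>"
    and Ya: "\<And>u. u \<in> ball 0 \<rho> \<Longrightarrow> Y u 0 = u ^ (2 * k - 1) * a u" and X0: "X 0 0 \<noteq> 0"
    and V: "of_real ?V = fact (2 * k - 1) * X 0 0 ^ (2 * k - 1) * a 0"
    by (rule contact_order[OF r X Y _ contact]) (use k in simp, blast)
  have "\<exists>R. 0 < R \<and> R < r \<and> (\<forall>u \<in> ball 0 R. \<forall>v \<in> ball 0 R. X u v \<noteq> 0)
      \<and> (\<forall>u v. \<bar>u\<bar> < R \<longrightarrow> \<bar>v\<bar> < R \<longrightarrow> (u, v) \<in> D)"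
  proof -
    have "continuous_on (ball 0 r \<times> ball 0 r) (\<lambda>p. X (fst p) (snd p))"
      using X by (simp add: complexifies_def holo2_def split_beta)
    moreover have "open (ball 0 r \<times> ball 0 r :: (complex \<times> complex) set)" by (simp add: open_Times)
    ultimately have "isCont (\<lambda>p. X (fst p) (snd p)) (0, 0)"
      using r by (auto simp: continuous_on_eq_continuous_at)
    then obtain e where e: "0 < e" "\<And>q. dist (0, 0) q < e \<Longrightarrow> X (fst q) (snd q) \<noteq> 0"
      using continuous_at_avoid[of "(0, 0)" "\<lambda>p. X (fst p) (snd p)" 0] X0 by auto
    obtain d where d: "0 < d" "ball (0, 0) d \<subseteq> D" by (rule openE[OF D])
    \<comment> \<open>The halves of \<open>e\<close> and \<open>d\<close> are there because the norm
      of a pair is bounded by the sum of the norms of its entries.\<close>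
    define R where "R = min (r / 2) (min (e / 2) (d / 2))"
    have R: "0 < R" "R < r" "R \<le> e / 2" "R \<le> d / 2" using r e(1) d(1) by (auto simp: R_def)
    have "X u v \<noteq> 0" if "u \<in> ball 0 R" "v \<in> ball 0 R" for u v
      using e(2)[of "(u, v)"] norm_Pair_le[of u v] that R(3) by (simp add: dist_norm norm_Pair)
    moreover have "(u, v) \<in> D" if "\<bar>u\<bar> < R" "\<bar>v\<bar> < R" for u v :: real
    proof (rule subsetD[OF d(2)])
      show "(u, v) \<in> ball (0, 0) d"
        using norm_Pair_le[of u v] that R(4) by (simp add: dist_norm norm_Pair)
    qed
    ultimately show ?thesis using R(1,2) by blast
  qed
  then obtain R where R: "0 < R" "R < r" and Xnz: "\<And>u v. u \<in> ball 0 R \<Longrightarrow> v \<in> ball 0 R \<Longrightarrow> X u v \<noteq> 0"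
    and inD: "\<And>u v. \<bar>u\<bar> < R \<Longrightarrow> \<bar>v\<bar> < R \<Longrightarrow> (u, v) \<in> D" by blast
  have XR: "complexifies R X (\<lambda>p. fst (F p))" and YR: "complexifies R Y (\<lambda>p. snd (F p))"
    using complexifies_mono[OF X] complexifies_mono[OF Y] R by auto
  have Xr: "X (of_real u) (of_real v) = of_real (fst (F (u, v)))"
    and Yr: "Y (of_real u) (of_real v) = of_real (snd (F (u, v)))" if "\<bar>u\<bar> < R" "\<bar>v\<bar> < R" for u v
    using XR YR that by (simp_all add: complexifies_def)
  have Fnz: "fst (F (u, v)) \<noteq> 0" if "\<bar>u\<bar> < R" "\<bar>v\<bar> < R" for u v
    using Xnz[of "of_real u" "of_real v"] Xr[OF that] that by auto
  define f where "f u v = Y u v / X u v" for u v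
  define g where "g u v = snd (F (u, v)) / fst (F (u, v))" for u v
  have f: "holo2 R f"
    unfolding f_def using XR YR Xnz by (intro holo2_divide) (auto simp: complexifies_def)
  have fg: "f (of_real u) (of_real v) = of_real (g u v)" if "\<bar>u\<bar> < R" "\<bar>v\<bar> < R" for u v
    using Xr[OF that] Yr[OF that] by (simp add: f_def g_def)
  define \<rho>' where "\<rho>' = min \<rho> R"
  have \<rho>': "0 < \<rho>'" "\<rho>' \<le> \<rho>" "\<rho>' \<le> R" using \<rho> R by (auto simp: \<rho>'_def)
  define b where "b u = a u / X u 0" for u
  have hX: "(\<lambda>u. X u 0) holomorphic_on ball 0 R"
    using XR R by (simp add: complexifies_def holo2_def)
  have b: "b holomorphic_on ball 0 \<rho>'"
    unfolding b_def
    by (intro holomorphic_on_divide holomorphic_on_subset[OF a] holomorphic_on_subset[OF hX])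
      (use \<rho>' R Xnz in \<open>auto simp: ball_subset_ball_iff\<close>)
  have fb: "f u 0 = u ^ p * b u" if "u \<in> ball 0 \<rho>'" for u
    using Ya[of u] that \<rho>' p(1) by (simp add: f_def b_def)
  define X0r where "X0r = fst (F (0, 0))"
  have X0r: "X 0 0 = of_real X0r" "X0r \<noteq> 0"
    using Xr[of 0 0] Fnz[of 0 0] R by (auto simp: X0r_def)
  \<comment> \<open>The leading coefficient of \<open>f u 0\<close>, obtained by solving
    \<open>V\<close> for \<open>a 0\<close> and dividing by \<open>X 0 0\<close>. The exponent
    \<open>Suc p = 2 * k\<close> is even, so \<open>c\<close> has the sign of the Lie derivative
    whatever the direction of the horizontal motion.\<close>
  define c where "c = ?V / (fact p * X0r ^ Suc p)"
  have "2 * k - 1 = p" using p(1) by simp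
  then have "a 0 = of_real ?V / (fact p * of_real X0r ^ p)"
    using V X0r by simp
  then have b0: "b 0 = of_real c" using X0r by (simp add: b_def c_def)
  have "0 < X0r ^ Suc p" using p(2) X0r(2) by (subst zero_less_power_eq) simp
  then have c: "\<sigma> * c < 0"
    using invis unfolding c_def times_divide_eq_right by (intro divide_neg_pos mult_pos_pos) auto
  \<comment> \<open>Strictly below \<open>R\<close>, as the Lipschitz bounds for the components of
    \<open>F\<close> require.\<close>
  define B where "B = R / 2"
  have B: "0 < B" "B < R" using R by (auto simp: B_def)
  obtain \<epsilon>' \<phi> where \<epsilon>': "0 < \<epsilon>'" and \<phi>: "\<phi> holomorphic_on ball 0 \<epsilon>'" "\<phi> 0 = 0"
    and ret: "\<And>x. x \<noteq> 0 \<Longrightarrow> \<bar>x\<bar> < \<epsilon>' \<Longrightarrow> g x 0 \<noteq> 0 \<and>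
      (\<exists>x' \<eta>. \<phi> (of_real x) = of_real x' \<and> x \<noteq> x' \<and> graph_arc g \<sigma> B x x' \<eta>)"
    using analytic_return_graph[OF f R(1) B(1) fg \<rho>'(1) b fb p(2) b0 \<sigma> c] by blast
  let ?Q = "{p :: real \<times> real. \<bar>fst p\<bar> < B \<and> \<bar>snd p\<bar> < B}"
  have Q: "open ?Q" by (intro open_Collect_conj open_Collect_less continuous_intros)
  obtain L1 where L1: "0 < L1" "\<And>u v u' v'. \<bar>u\<bar> < B \<Longrightarrow> \<bar>v\<bar> < B \<Longrightarrow> \<bar>u'\<bar> < B \<Longrightarrow> \<bar>v'\<bar> < B \<Longrightarrow>
      \<bar>fst (F (u, v)) - fst (F (u', v'))\<bar> \<le> L1 * (\<bar>u - u'\<bar> + \<bar>v - v'\<bar>)"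
    using complexifies_Lipschitz[OF XR B] by blast
  obtain L2 where L2: "0 < L2" "\<And>u v u' v'. \<bar>u\<bar> < B \<Longrightarrow> \<bar>v\<bar> < B \<Longrightarrow> \<bar>u'\<bar> < B \<Longrightarrow> \<bar>v'\<bar> < B \<Longrightarrow>
      \<bar>snd (F (u, v)) - snd (F (u', v'))\<bar> \<le> L2 * (\<bar>u - u'\<bar> + \<bar>v - v'\<bar>)"
    using complexifies_Lipschitz[OF YR B] by blast
  define L where "L = (L1 + L2) * 2"
  have L: "0 \<le> L" using L1(1) L2(1) by (simp add: L_def)
  have norm_pair: "norm z \<le> \<bar>fst z\<bar> + \<bar>snd z\<bar>" for z :: "real \<times> real"
    using norm_Pair_le[of "fst z" "snd z"] by simp
  have pair_norm: "\<bar>fst z\<bar> \<le> norm z" "\<bar>snd z\<bar> \<le> norm z" for z :: "real \<times> real"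
    using norm_fst_le[of "fst z" "snd z"] norm_snd_le[of "snd z" "fst z"] by simp_all
  have lip: "norm (F p - F q) \<le> L * norm (p - q)" if "p \<in> ?Q" "q \<in> ?Q" for p q
  proof -
    let ?s = "\<bar>fst p - fst q\<bar> + \<bar>snd p - snd q\<bar>"
    have "norm (F p - F q) \<le> \<bar>fst (F p) - fst (F q)\<bar> + \<bar>snd (F p) - snd (F q)\<bar>"
      using norm_pair[of "F p - F q"] by simp
    also have "\<dots> \<le> L1 * ?s + L2 * ?s"
      using L1(2)[of "fst p" "snd p" "fst q" "snd q"] L2(2)[of "fst p" "snd p" "fst q" "snd q"] that
      by (intro add_mono) auto
    also have "\<dots> = (L1 + L2) * ?s" by (simp add: distrib_right)
    also have "\<dots> \<le> (L1 + L2) * (2 * norm (p - q))"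
      using L1(1) L2(1) pair_norm[of "p - q"]
      by (intro mult_left_mono) auto
    finally show ?thesis by (simp only: L_def mult.assoc)
  qed
  have contF: "continuous_on ?Q F"
  proof (rule lipschitz_on_continuous_on)
    show "L-lipschitz_on ?Q F" using L lip by (intro lipschitz_onI) (auto simp: dist_norm)
  qed
  have \<sigma>0: "\<sigma> \<noteq> 0" using \<sigma> by auto
  let ?H = "{p :: real \<times> real. 0 < \<sigma> * snd p}"
  define \<epsilon> where "\<epsilon> = min \<epsilon>' R"
  have \<epsilon>: "0 < \<epsilon>" "\<epsilon> \<le> \<epsilon>'" "\<epsilon> \<le> R" using \<epsilon>' R by (auto simp: \<epsilon>_def)
  have first: "\<exists>x'. \<phi> (of_real x) = of_real x' \<and> first_return D ?H F x x' \<and>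
      (\<forall>x''. first_return D ?H F x x'' \<longrightarrow> x'' = x')" if x: "x \<noteq> 0" "\<bar>x\<bar> < \<epsilon>" for x
  proof -
    have x\<epsilon>: "\<bar>x\<bar> < \<epsilon>'" using x \<epsilon> by simp
    obtain x' \<eta> where x': "\<phi> (of_real x) = of_real x'" "x \<noteq> x'" and arc: "graph_arc g \<sigma> B x x' \<eta>"
      using ret[OF x(1) x\<epsilon>] by blast
    have Fx: "snd (F (x, 0)) \<noteq> 0" using ret[OF x(1) x\<epsilon>] by (auto simp: g_def)
    \<comment> \<open>The arc is first placed in the square \<open>?Q\<close>, where
      \<open>F\<close> is Lipschitz, which uniqueness requires of one of the two arcs; existence in
      \<open>D\<close> follows by inclusion.\<close>
    obtain T \<gamma> where \<gamma>: "return_arc ?Q \<sigma> F x x' T \<gamma>"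
    proof (rule graph_arc_imp_return_arc[OF x'(2) _ contF])
      show "graph_arc (\<lambda>u v. snd (F (u, v)) / fst (F (u, v))) \<sigma> B x x' \<eta>"
        using arc by (simp add: g_def[abs_def])
      show "fst (F p) \<noteq> 0" if "p \<in> ?Q" for p
        using Fnz[of "fst p" "snd p"] that B(2) by simp
    qed auto
    have "?Q \<subseteq> D" using inD B(2) by fastforce
    then have "return_arc D \<sigma> F x x' T \<gamma>" using \<gamma> unfolding return_arc_def by blast
    then have "first_return D ?H F x x'" unfolding first_return_iff by blast
    moreover have "x'' = x'" if x'': "first_return D ?H F x x''" for x''
    proof -
      obtain S \<theta> where "return_arc D \<sigma> F x x'' S \<theta>" using x'' unfolding first_return_iff by blast
      from return_arc_unique[OF Q L lip \<gamma> this \<sigma>0 Fx] show ?thesis .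
    qed
    ultimately show ?thesis using x'(1) by blast
  qed
  have hr: "\<phi> (of_real x) = of_real (half_return D ?H F x)" if x: "\<bar>x\<bar> < \<epsilon>" for x
  proof (cases "x = 0")
    case True
    then show ?thesis using \<phi>(2) by (simp add: half_return_def)
  next
    case False
    obtain x' where x': "\<phi> (of_real x) = of_real x'" "first_return D ?H F x x'"
      "\<forall>x''. first_return D ?H F x x'' \<longrightarrow> x'' = x'"
      using first[OF False x] by blast
    have "(THE x'. first_return D ?H F x x') = x'"
      by (rule the_equality) (fact x'(2), rule x'(3)[rule_format])
    then show ?thesis using False x'(1) by (simp add: half_return_def)
  qed
  have h\<phi>: "\<phi> holomorphic_on ball 0 \<epsilon>"
    by (rule holomorphic_on_subset[OF \<phi>(1)]) (use \<epsilon> in auto)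
  have "real_analytic_on (half_return D ?H F) {- \<epsilon><..<\<epsilon>}"
    by (rule real_analytic_on_real_trace[OF h\<phi> hr])
  moreover have "\<exists>!x'. first_return D ?H F x x'" if "x \<noteq> 0 \<and> \<bar>x\<bar> < \<epsilon>" for x
    using first[of x] that by blast
  ultimately show ?thesis unfolding half_return_analytic_near_0_def using \<epsilon>(1) by blast
qed

theorem theoremA:
  fixes D :: "(real \<times> real) set"
    and Zp Zm :: "real \<times> real \<Rightarrow> real \<times> real"
    and kp km :: nat
  assumes "open D" and "(0, 0) \<in> D" and "kp > 0" and "km > 0"
  shows "(analytic_vector_field_on Zp D \<and> invisible_contact_plus Zp kp \<longrightarrow>
            half_return_analytic_near_0 D upper_half_plane Zp) \<and>
         (analytic_vector_field_on Zm D \<and> invisible_contact_minus Zm km \<longrightarrow>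
            half_return_analytic_near_0 D lower_half_plane Zm)"
proof (intro conjI impI; elim conjE)
  assume "analytic_vector_field_on Zp D" "invisible_contact_plus Zp kp"
  then have "half_return_analytic_near_0 D {p. 0 < 1 * snd p} Zp"
    using assms by (intro half_return_analytic[where k = kp]) (auto simp: invisible_contact_plus_def)
  then show "half_return_analytic_near_0 D upper_half_plane Zp"
    by (simp add: upper_half_plane_def)
next
  assume "analytic_vector_field_on Zm D" "invisible_contact_minus Zm km"
  then have "half_return_analytic_near_0 D {p. 0 < (- 1) * snd p} Zm"
    using assms by (intro half_return_analytic[where k = km]) (auto simp: invisible_contact_minus_def)
  then show "half_return_analytic_near_0 D lower_half_plane Zm"
    by (simp add: lower_half_plane_def)
qed

end
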